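(* Let $K$ be an algebraically closed field of characteristic zero and let $d\ge 1$ be an integer. For each integer $r$ with $1\le r\le\left[\frac d2\right]+1$, $$\overline{S_{d,r}}=\bigcup_{i=1}^{r}S_{d,i}\ \cup\bigcup_{i=d-r+2}^{d}S_{d,i}.$$
   Context: $S_d$ is the $K$-vector space of homogeneous polynomials of degree $d$ in two variables $x,y$ (binary forms), with $S_1$ the linear forms. The rank of $q\in S_d$ is the least integer $r\ge 1$ such that $q=L_1^d+\dots+L_r^d$ with $L_i\in S_1$ (the $L_i$ are allowed to be zero, so the zero form has rank $1$). $S_{d,r}=\{q\in S_d:\operatorname{rank} q=r\}$. The bar denotes Zariski closure in the affine space $S_d$. $[\cdot]$ denotes the integer part. A union over an empty range of indices is empty. *)

theory Defs
  imports Complex_Main "HOL-Computational_Algebra.Polynomial"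
begin

text \<open>
  The ring $K[x,y]$ is represented as $K[x][y]$, the type of polynomials in \<open>y\<close> whose
  coefficients are polynomials in \<open>x\<close>; so \<open>coeff (coeff q j) i\<close> is the coefficient of
  $x^i y^j$ in \<open>q\<close>. The zero polynomial is homogeneous of every degree.
\<close>

definition binary_forms :: "nat \<Rightarrow> 'a::comm_semiring_1 poly poly set" where
  "binary_forms d = {q. \<forall>i j. coeff (coeff q j) i \<noteq> 0 \<longrightarrow> i + j = d}"

definition form_rank :: "nat \<Rightarrow> 'a::comm_semiring_1 poly poly \<Rightarrow> nat" where
  "form_rank d q =
    (LEAST r. r \<ge> 1 \<and> (\<exists>L. (\<forall>i<r. L i \<in> binary_forms 1) \<and> q = (\<Sum>i<r. L i ^ d)))"

definition rank_stratum :: "nat \<Rightarrow> nat \<Rightarrow> 'a::comm_semiring_1 poly poly set" where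
  "rank_stratum d r = {q \<in> binary_forms d. form_rank d q = r}"

text \<open>
  The functions that are polynomial expressions in the coordinates of a form of degree \<open>d\<close>,
  namely its coefficients in the monomial basis. Only their values on \<open>binary_forms d\<close> are
  relevant below.
\<close>

inductive polynomial_on_forms :: "nat \<Rightarrow> ('a::comm_semiring_1 poly poly \<Rightarrow> 'a) \<Rightarrow> bool"
  for d where
  const: "polynomial_on_forms d (\<lambda>q. c)"
| coord: "i + j = d \<Longrightarrow> polynomial_on_forms d (\<lambda>q. coeff (coeff q j) i)"
| add: "polynomial_on_forms d f \<Longrightarrow> polynomial_on_forms d g \<Longrightarrow>
    polynomial_on_forms d (\<lambda>q. f q + g q)"
| mult: "polynomial_on_forms d f \<Longrightarrow> polynomial_on_forms d g \<Longrightarrow>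
    polynomial_on_forms d (\<lambda>q. f q * g q)"

definition zariski_closed :: "nat \<Rightarrow> 'a::comm_semiring_1 poly poly set \<Rightarrow> bool" where
  "zariski_closed d Z \<longleftrightarrow>
    (\<exists>F. (\<forall>f\<in>F. polynomial_on_forms d f) \<and> Z = {q \<in> binary_forms d. \<forall>f\<in>F. f q = 0})"

definition zariski_closure :: "nat \<Rightarrow> 'a::comm_semiring_1 poly poly set \<Rightarrow> 'a poly poly set" where
  "zariski_closure d A = zariski_closed d hull A"

end

theory Submission
  imports Defs "Jordan_Normal_Form.Determinant"
begin

text \<open>
  The proof identifies both sides with the locus $X_r$ of forms \<open>q\<close> of degree \<open>d\<close> that are
  annihilated, under contraction, by some nonzero form \<open>g\<close> of degree \<open>r\<close>, i.e. that have an
  apolar form of degree \<open>r\<close>. In the coordinates \<open>dual_coeff\<close> the annihilation says that the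
  coordinate sequence of \<open>q\<close> satisfies the linear recurrence with characteristic polynomial
  \<open>g\<close>.

  \<^bold>\<open>The ranks occurring in $X_r$.\<close> A sum of \<open>r\<close> powers is annihilated by the product of the
  linear forms dual to its summands. If $q \in X_r$ has rank $n \le d - r + 1$, the powers of degree
  $d - r$ of the \<open>n\<close> linear forms in a shortest decomposition are independent, so all \<open>n\<close>
  points are roots of \<open>g\<close> and $n \le r$ (\<open>apolar_imp_length_le\<close>). If $q \notin X_r$, the
  apolar forms of degree $d - r + 1$ have no common root; by Bertini's theorem one of them is
  squarefree, and by Sylvester's theorem \<open>q\<close> is a sum of $d - r + 1$ powers
  (\<open>not_apolar_imp_power_sum\<close>). Together these show that $X_r$ consists of the forms of rank at
  most \<open>r\<close> or at least $d - r + 2$ (\<open>apolar_iff_form_rank\<close>).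

  \<^bold>\<open>$X_r$ is the closure.\<close> It is closed, being given by the degeneracy of a Hankel matrix
  (\<open>zariski_closed_apolar_forms\<close>). Conversely, every $q \in X_r$ is a limit of sums of \<open>r\<close>
  powers: moving the roots of \<open>g\<close> apart along a line, while keeping the initial values of the
  recurrence, gives a polynomial curve through \<open>q\<close> whose general member has a squarefree apolar
  form of degree \<open>r\<close> (\<open>apolar_deformation\<close>). Finally, moving the linear forms themselves into
  general position shows that a sum of \<open>r\<close> powers is a limit of forms of rank exactly \<open>r\<close>
  (\<open>power_sum_forms_subset_closure\<close>); this is the step that needs $r \le [d/2] + 1$.
\<close>

section \<open>Coordinates on binary forms\<close>

text \<open>
  The binomial coefficient is divided out so that the \<open>d\<close>-th power of a linear form
  $\alpha x + \beta y$ has the coordinates $\alpha^{d-m}\beta^m$. In these coordinates apolarity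
  becomes a linear recurrence.
\<close>

definition dual_coeff :: "nat \<Rightarrow> 'a::field_char_0 poly poly \<Rightarrow> nat \<Rightarrow> 'a" where
  "dual_coeff d q m = coeff (coeff q m) (d - m) / of_nat (d choose m)"

definition form_of_seq :: "nat \<Rightarrow> (nat \<Rightarrow> 'a::field_char_0) \<Rightarrow> 'a poly poly" where
  "form_of_seq d a = (\<Sum>m\<le>d. monom (monom (of_nat (d choose m) * a m) (d - m)) m)"

definition linear_form :: "'a::field_char_0 \<Rightarrow> 'a \<Rightarrow> 'a poly poly" where
  "linear_form \<alpha> \<beta> = monom (monom \<alpha> 1) 0 + monom (monom \<beta> 0) 1"

lemma coeff_form_of_seq:
  "coeff (coeff (form_of_seq d a) j) i = (if i + j = d then of_nat (d choose j) * a j else 0)"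
proof -
  have "coeff (coeff (form_of_seq d a) j) i =
      (\<Sum>m\<le>d. if m = j then (if d - m = i then of_nat (d choose m) * a m else 0) else 0)"
    unfolding form_of_seq_def coeff_sum coeff_monom
    by (intro sum.cong refl) (auto simp: coeff_monom)
  also have "\<dots> = (if j \<le> d then (if d - j = i then of_nat (d choose j) * a j else 0) else 0)"
    by (subst sum.delta) auto
  also have "\<dots> = (if i + j = d then of_nat (d choose j) * a j else 0)"
    by auto
  finally show ?thesis .
qed

lemma form_of_seq_in: "form_of_seq d a \<in> binary_forms d"
  by (auto simp: binary_forms_def coeff_form_of_seq split: if_splits)

lemma dual_coeff_form_of_seq: "m \<le> d \<Longrightarrow> dual_coeff d (form_of_seq d a) m = a m"
  by (simp add: dual_coeff_def coeff_form_of_seq)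

lemma form_of_seq_dual_coeff:
  assumes "q \<in> binary_forms d"
  shows "form_of_seq d (dual_coeff d q) = q"
proof (intro poly_eqI)
  fix j i
  show "coeff (coeff (form_of_seq d (dual_coeff d q)) j) i = coeff (coeff q j) i"
    using assms by (auto simp: coeff_form_of_seq dual_coeff_def binary_forms_def)
qed

lemma form_of_seq_cong:
  "(\<And>m. m \<le> d \<Longrightarrow> a m = b m) \<Longrightarrow> form_of_seq d a = form_of_seq d b"
  unfolding form_of_seq_def by (intro sum.cong) auto

lemma form_of_seq_sum:
  "form_of_seq d (\<lambda>m. \<Sum>j\<in>J. f j m) = (\<Sum>j\<in>J. form_of_seq d (f j))"
  by (intro poly_eqI) (auto simp: coeff_sum coeff_form_of_seq sum_distrib_left)

lemma linear_form_power:
  "linear_form \<alpha> \<beta> ^ d = form_of_seq d (\<lambda>m. \<alpha> ^ (d - m) * \<beta> ^ m)"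
proof -
  have "linear_form \<alpha> \<beta> ^ d = (\<Sum>m\<le>d. of_nat (d choose m) *
      monom (monom \<beta> 0) 1 ^ m * monom (monom \<alpha> 1) 0 ^ (d - m))"
    unfolding linear_form_def by (subst add.commute) (rule binomial_ring)
  also have "\<dots> = form_of_seq d (\<lambda>m. \<alpha> ^ (d - m) * \<beta> ^ m)"
    unfolding form_of_seq_def
    by (intro sum.cong refl)
       (simp add: monom_power mult_monom of_nat_monom mult_ac)
  finally show ?thesis .
qed

lemma linear_forms_iff:
  "L \<in> binary_forms 1 \<longleftrightarrow> (\<exists>\<alpha> \<beta>. L = linear_form \<alpha> \<beta>)"
proof
  assume L: "L \<in> binary_forms 1"
  have "L = form_of_seq 1 (dual_coeff 1 L)"
    using form_of_seq_dual_coeff[OF L] by simp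
  also have "\<dots> = form_of_seq 1 (\<lambda>m. dual_coeff 1 L 0 ^ (1 - m) * dual_coeff 1 L 1 ^ m)"
    by (intro form_of_seq_cong) (auto simp: le_Suc_eq)
  also have "\<dots> = linear_form (dual_coeff 1 L 0) (dual_coeff 1 L 1)"
    by (simp flip: linear_form_power)
  finally show "\<exists>\<alpha> \<beta>. L = linear_form \<alpha> \<beta>" by blast
next
  assume "\<exists>\<alpha> \<beta>. L = linear_form \<alpha> \<beta>"
  then obtain \<alpha> \<beta> where "L = linear_form \<alpha> \<beta>" by blast
  thus "L \<in> binary_forms 1"
    using linear_form_power[of \<alpha> \<beta> 1] form_of_seq_in[of 1] by simp
qed

definition power_sum :: "nat \<Rightarrow> nat \<Rightarrow> (nat \<Rightarrow> 'a::field_char_0) \<Rightarrow> bool" where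
  "power_sum d n a \<longleftrightarrow> (\<exists>\<alpha> \<beta>. \<forall>m\<le>d. a m = (\<Sum>j<n. \<alpha> j ^ (d - m) * \<beta> j ^ m))"

lemma sum_of_powers_iff:
  assumes "q \<in> binary_forms d"
  shows "(\<exists>L. (\<forall>i<n. L i \<in> binary_forms 1) \<and> q = (\<Sum>i<n. L i ^ d)) \<longleftrightarrow>
    power_sum d n (dual_coeff d q)"
proof
  assume "\<exists>L. (\<forall>i<n. L i \<in> binary_forms 1) \<and> q = (\<Sum>i<n. L i ^ d)"
  then obtain L where L: "\<forall>i<n. L i \<in> binary_forms 1" and q: "q = (\<Sum>i<n. L i ^ d)"
    by blast
  from L obtain \<alpha> \<beta> where "\<forall>i<n. L i = linear_form (\<alpha> i) (\<beta> i)"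
    unfolding linear_forms_iff by metis
  with q have "q = (\<Sum>i<n. form_of_seq d (\<lambda>m. \<alpha> i ^ (d - m) * \<beta> i ^ m))"
    by (simp add: linear_form_power)
  hence "q = form_of_seq d (\<lambda>m. \<Sum>i<n. \<alpha> i ^ (d - m) * \<beta> i ^ m)"
    by (simp add: form_of_seq_sum)
  thus "power_sum d n (dual_coeff d q)"
    unfolding power_sum_def by (auto simp: dual_coeff_form_of_seq)
next
  assume "power_sum d n (dual_coeff d q)"
  then obtain \<alpha> \<beta> where
    *: "\<And>m. m \<le> d \<Longrightarrow> dual_coeff d q m = (\<Sum>j<n. \<alpha> j ^ (d - m) * \<beta> j ^ m)"
    unfolding power_sum_def by blast
  have "q = form_of_seq d (dual_coeff d q)"
    using form_of_seq_dual_coeff[OF assms] by simp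
  also have "\<dots> = form_of_seq d (\<lambda>m. \<Sum>j<n. \<alpha> j ^ (d - m) * \<beta> j ^ m)"
    by (intro form_of_seq_cong *)
  also have "\<dots> = (\<Sum>i<n. linear_form (\<alpha> i) (\<beta> i) ^ d)"
    by (simp add: form_of_seq_sum linear_form_power)
  finally show "\<exists>L. (\<forall>i<n. L i \<in> binary_forms 1) \<and> q = (\<Sum>i<n. L i ^ d)"
    by (intro exI[of _ "\<lambda>i. linear_form (\<alpha> i) (\<beta> i)"]) (use linear_forms_iff in blast)
qed

lemma form_rank_eq:
  assumes "q \<in> binary_forms d"
  shows "form_rank d q = (LEAST n. n \<ge> 1 \<and> power_sum d n (dual_coeff d q))"
  unfolding form_rank_def sum_of_powers_iff[OF assms] ..

text \<open>
  Over an algebraically closed field a coefficient in front of a \<open>d\<close>-th power is itself a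
  \<open>d\<close>-th power and is absorbed into the linear form.
\<close>

lemma weighted_power_sumI:
  fixes a :: "nat \<Rightarrow> 'a::{alg_closed_field, field_char_0}"
  assumes "d \<ge> 1" "finite J"
    and a: "\<And>m. m \<le> d \<Longrightarrow> a m = (\<Sum>j\<in>J. c j * \<alpha> j ^ (d - m) * \<beta> j ^ m)"
  shows "power_sum d (card J) a"
proof -
  have "\<exists>s. s ^ d = c j" for j
    using nth_root_exists[of d "c j"] assms(1) by auto
  then obtain s where s: "\<And>j. s j ^ d = c j" by metis
  have absorb: "c j * \<alpha> j ^ (d - m) * \<beta> j ^ m = (s j * \<alpha> j) ^ (d - m) * (s j * \<beta> j) ^ m"
    if "m \<le> d" for j m
  proof -
    have "c j = s j ^ (d - m) * s j ^ m"
      using that s[of j] by (simp flip: power_add)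
    thus ?thesis by (simp add: power_mult_distrib mult_ac)
  qed
  obtain h where h: "bij_betw h {..<card J} J"
    using ex_bij_betw_nat_finite[OF assms(2)] by (auto simp: lessThan_atLeast0)
  have "a m = (\<Sum>i<card J. (s (h i) * \<alpha> (h i)) ^ (d - m) * (s (h i) * \<beta> (h i)) ^ m)"
    if "m \<le> d" for m
    by (simp only: a[OF that] absorb[OF that] sum.reindex_bij_betw[OF h, symmetric])
  thus ?thesis
    unfolding power_sum_def
    by (intro exI[of _ "\<lambda>i. s (h i) * \<alpha> (h i)"] exI[of _ "\<lambda>i. s (h i) * \<beta> (h i)"]) auto
qed

lemma power_sum_add:
  assumes "power_sum d n a" "power_sum d k b"
  shows "power_sum d (n + k) (\<lambda>m. a m + b m)"
proof -
  obtain \<alpha> \<beta> where a: "\<And>m. m \<le> d \<Longrightarrow> a m = (\<Sum>j<n. \<alpha> j ^ (d - m) * \<beta> j ^ m)"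
    using assms(1) unfolding power_sum_def by blast
  obtain \<gamma> \<delta> where b: "\<And>m. m \<le> d \<Longrightarrow> b m = (\<Sum>j<k. \<gamma> j ^ (d - m) * \<delta> j ^ m)"
    using assms(2) unfolding power_sum_def by blast
  have split: "(\<Sum>j<n + k. f j) = (\<Sum>j<n. f j) + (\<Sum>j<k. f (n + j))" for f :: "nat \<Rightarrow> 'a"
    by (induction k) (simp_all add: add.assoc)
  show ?thesis
    unfolding power_sum_def
    by (rule exI[of _ "\<lambda>j. if j < n then \<alpha> j else \<gamma> (j - n)"],
        rule exI[of _ "\<lambda>j. if j < n then \<beta> j else \<delta> (j - n)"])
       (simp add: split a b)
qed

lemma power_sum_rev:
  assumes "power_sum d n a" shows "power_sum d n (\<lambda>m. a (d - m))"
proof -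
  obtain \<alpha> \<beta> where a: "\<And>m. m \<le> d \<Longrightarrow> a m = (\<Sum>j<n. \<alpha> j ^ (d - m) * \<beta> j ^ m)"
    using assms(1) unfolding power_sum_def by blast
  show ?thesis unfolding power_sum_def
    by (rule exI[of _ \<beta>], rule exI[of _ \<alpha>]) (auto simp: a mult.commute)
qed

section \<open>Contraction of a sequence by a polynomial\<close>

text \<open>
  This makes sequences a module over the polynomial ring, the variable acting as the shift.
  On dual coordinates it is the contraction of a form by the differential operator that
  dehomogenises to \<open>p\<close>.
\<close>

definition contract :: "'a::field_char_0 poly \<Rightarrow> (nat \<Rightarrow> 'a) \<Rightarrow> nat \<Rightarrow> 'a" where
  "contract p a m = (\<Sum>l\<le>degree p. coeff p l * a (l + m))"

lemma contract_altdef: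
  "degree p \<le> n \<Longrightarrow> contract p a m = (\<Sum>l\<le>n. coeff p l * a (l + m))"
  unfolding contract_def
  by (intro sum.mono_neutral_left) (auto simp: not_le intro: coeff_eq_0)

lemma contract_0 [simp]: "contract 0 a m = 0"
  by (simp add: contract_def)

lemma contract_pCons: "contract (pCons c p) a m = c * a m + contract p a (Suc m)"
proof -
  have "contract (pCons c p) a m = (\<Sum>l\<le>Suc (degree p). coeff (pCons c p) l * a (l + m))"
    by (intro contract_altdef) (rule degree_pCons_le)
  thus ?thesis
    by (subst (asm) sum.atMost_Suc_shift) (simp add: contract_def)
qed

lemma contract_add: "contract (p + q) a m = contract p a m + contract q a m"
proof -
  let ?n = "max (degree p) (degree q)"
  have "contract (p + q) a m = (\<Sum>l\<le>?n. coeff (p + q) l * a (l + m))"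
    by (intro contract_altdef degree_add_le) auto
  thus ?thesis
    by (simp add: contract_altdef[of p ?n] contract_altdef[of q ?n] sum.distrib distrib_right)
qed

lemma contract_smult: "contract (Polynomial.smult c p) a m = c * contract p a m"
  by (simp add: contract_altdef[of "Polynomial.smult c p" "degree p"] contract_altdef[of p "degree p"]
      degree_smult_le sum_distrib_left mult.assoc)

lemma contract_mult: "contract (p * q) a m = contract p (contract q a) m"
proof (induction p arbitrary: m)
  case (pCons c p)
  have "contract (pCons c p * q) a m = c * contract q a m + contract (pCons 0 (p * q)) a m"
    by (simp add: contract_add contract_smult)
  also have "contract (pCons 0 (p * q)) a m = contract (p * q) a (Suc m)"
    by (simp only: contract_pCons mult_zero_left add_0_left)
  finally show ?case by (simp add: pCons.IH contract_pCons)
qed simp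

lemma contract_mult': "contract (p * q) a m = contract q (contract p a) m"
  by (subst mult.commute) (rule contract_mult)

lemma contract_monom: "contract (monom c n) a m = c * a (n + m)"
  by (induction n arbitrary: m) (simp_all add: monom_0 monom_Suc contract_pCons)

text \<open>
  The annihilating form of degree \<open>r\<close> is represented by its dehomogenisation \<open>g\<close>, whose degree
  drops when there are roots at infinity. The bound on \<open>m\<close> keeps the condition to the entries
  $a_0, \dots, a_d$. Equivalently, for $r \le d$, the Hankel matrix $(a_{l+m})$ with $l \le r$,
  $m \le d - r$ has a nontrivial kernel.
\<close>

definition apolar :: "nat \<Rightarrow> nat \<Rightarrow> (nat \<Rightarrow> 'a::field_char_0) \<Rightarrow> bool" where
  "apolar d r a \<longleftrightarrow>
    (\<exists>g. g \<noteq> 0 \<and> degree g \<le> r \<and> (\<forall>m. m + r \<le> d \<longrightarrow> contract g a m = 0))"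

lemma apolar_mono: "apolar d r a \<Longrightarrow> r \<le> s \<Longrightarrow> apolar d s a"
  unfolding apolar_def by (meson add_le_cancel_left le_trans)

text \<open>
  The annihilating form is the product of the linear forms vanishing at the points
  $(\alpha_j : \beta_j)$; each factor removes one summand and lowers the degree by one. The
  weights \<open>c\<close> are there for the induction, since a factor multiplies the remaining summands by
  constants.
\<close>

lemma apolar_of_weighted_sum:
  assumes "\<And>m. m \<le> d \<Longrightarrow> a m = (\<Sum>j<n. c j * \<alpha> j ^ (d - m) * \<beta> j ^ m)" "n \<le> d"
  shows "apolar d n a"
  using assms
proof (induction n arbitrary: d a c)
  case 0
  thus ?case unfolding apolar_def
    by (intro exI[of _ 1]) (simp add: one_pCons contract_pCons)
next
  case (Suc n)
  show ?case
  proof (cases "\<alpha> n = 0 \<and> \<beta> n = 0")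
    case True
    hence "c n * \<alpha> n ^ (d - m) * \<beta> n ^ m = 0" if "m \<le> d" for m
      using Suc.prems(2) by (cases m) auto
    with Suc have "apolar d n a" by auto
    thus ?thesis by (rule apolar_mono) simp
  next
    case False
    obtain d' where d: "d = Suc d'" using Suc.prems(2) by (cases d) auto
    define b where "b = contract [:\<beta> n, -\<alpha> n:] a"
    have "b m = (\<Sum>j<n. (c j * (\<beta> n * \<alpha> j - \<alpha> n * \<beta> j)) * \<alpha> j ^ (d' - m) * \<beta> j ^ m)"
      if "m \<le> d'" for m
    proof -
      have "b m = \<beta> n * a m - \<alpha> n * a (Suc m)"
        by (simp add: b_def contract_pCons)
      also have "\<dots> = (\<Sum>j<Suc n. c j * (\<beta> n * \<alpha> j - \<alpha> n * \<beta> j) * \<alpha> j ^ (d' - m) * \<beta> j ^ m)"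
        using that unfolding d
        by (simp add: Suc.prems(1) d Suc_diff_le sum_distrib_left ring_distribs
            sum_subtractf[symmetric] mult_ac del: sum.lessThan_Suc)
      finally show ?thesis by simp
    qed
    hence "apolar d' n b"
      using Suc.prems(2) d by (intro Suc.IH) auto
    then obtain g where g: "g \<noteq> 0" "degree g \<le> n" "\<And>m. m + n \<le> d' \<Longrightarrow> contract g b m = 0"
      unfolding apolar_def by blast
    have "g * [:\<beta> n, -\<alpha> n:] \<noteq> 0" using g(1) False by (metis mult_eq_0_iff neg_equal_0_iff_equal pCons_eq_0_iff)
    moreover have "degree (g * [:\<beta> n, -\<alpha> n:]) \<le> Suc n"
      using degree_mult_le[of g "[:\<beta> n, -\<alpha> n:]"] degree_pCons_le[of "\<beta> n" "[:-\<alpha> n:]"] g(2)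
      by simp
    ultimately show ?thesis
      unfolding apolar_def using g(3)
      by (intro exI[of _ "g * [:\<beta> n, -\<alpha> n:]"] conjI allI impI)
         (auto simp: contract_mult b_def d simp del: mult_pCons_right)
  qed
qed

section \<open>Solving the recurrence, with a deformation of its roots\<close>

text \<open>
  A solution of a recurrence with prescribed initial values depends polynomially on the roots
  $u_j$. Moving the roots along $u_j + t v_j$ therefore gives a polynomial curve of sequences, and
  at every \<open>t\<close> where the roots are distinct the solution is a combination of geometric
  sequences. The proof peels off one factor $T - u_k$ at a time, which turns the recurrence into an
  inhomogeneous one of order one.

  Two uses: for $t = 0$ and distinct $u_j$ this is Sylvester's theorem that a squarefree apolar form
  yields a decomposition; for repeated roots it exhibits the sequence as a limit of
  decomposable ones. The hypothesis on only the first \<open>N\<close> equations controls exactly the first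
  $N + k$ entries.
\<close>

lemma recurrence_deformation:
  fixes u v :: "nat \<Rightarrow> 'a::field_char_0"
  assumes "\<And>m. m < N \<Longrightarrow> contract (\<Prod>j<k. [:-u j, 1:]) a m = 0"
  shows "\<exists>P. (\<forall>m<N + k. poly (P m) 0 = a m) \<and>
    (\<forall>t. inj_on (\<lambda>j. u j + t * v j) {..<k} \<longrightarrow>
      (\<exists>c. \<forall>m. poly (P m) t = (\<Sum>j<k. c j * (u j + t * v j) ^ m)))"
  using assms
proof (induction k arbitrary: a)
  case 0
  thus ?case by (intro exI[of _ "\<lambda>_. 0"]) (auto simp: one_pCons contract_pCons)
next
  case (Suc k)
  define b where "b = contract [:-u k, 1:] a"
  have b: "b m = a (Suc m) - u k * a m" for m
    by (simp add: b_def contract_pCons)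
  have "contract (\<Prod>j<k. [:-u j, 1:]) b m = 0" if "m < N" for m
    using Suc.prems[OF that] by (simp only: prod.lessThan_Suc contract_mult b_def)
  then obtain Q where Q: "\<And>m. m < N + k \<Longrightarrow> poly (Q m) 0 = b m"
    and Qt: "\<And>t. inj_on (\<lambda>j. u j + t * v j) {..<k} \<Longrightarrow>
      \<exists>c. \<forall>m. poly (Q m) t = (\<Sum>j<k. c j * (u j + t * v j) ^ m)"
    using Suc.IH[of b] by blast
  define P where "P = rec_nat [:a 0:] (\<lambda>m p. [:u k, v k:] * p + Q m)"
  have P_0: "P 0 = [:a 0:]" and P_Suc: "P (Suc m) = [:u k, v k:] * P m + Q m" for m
    by (simp_all add: P_def)
  have "poly (P m) 0 = a m" if "m < N + Suc k" for m
    using that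
  proof (induction m)
    case (Suc m)
    have "poly (P (Suc m)) 0 = u k * poly (P m) 0 + poly (Q m) 0"
      by (simp add: P_Suc)
    also have "\<dots> = a (Suc m)"
      using Suc Q[of m] by (simp add: b)
    finally show ?case .
  qed (simp add: P_0)
  moreover have "\<exists>c. \<forall>m. poly (P m) t = (\<Sum>j<Suc k. c j * (u j + t * v j) ^ m)"
    if inj: "inj_on (\<lambda>j. u j + t * v j) {..<Suc k}" for t
  proof -
    define w where "w j = u j + t * v j" for j
    have "inj_on (\<lambda>j. u j + t * v j) {..<k}"
      using inj by (rule inj_on_subset) auto
    then obtain c where c: "\<And>m. poly (Q m) t = (\<Sum>j<k. c j * w j ^ m)"
      using Qt unfolding w_def by blast
    have ne: "w j - w k \<noteq> 0" if "j < k" for j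
      using inj_onD[OF inj, of j k] that by (auto simp: w_def)
    \<comment> \<open>The shift minus $w_k$ multiplies the sequence $w_j^m$ by $w_j - w_k$, which gives the first
      coefficients; the multiple of $w_k^m$, which it kills, adjusts the value at $m = 0$.\<close>
    define c' where "c' j = (if j < k then c j / (w j - w k)
      else a 0 - (\<Sum>i<k. c i / (w i - w k)))" for j
    have "poly (P m) t = (\<Sum>j<Suc k. c' j * w j ^ m)" for m
    proof (induction m)
      case 0
      thus ?case by (simp add: P_0 c'_def)
    next
      case (Suc m)
      have *: "c' j * w j ^ Suc m = w k * (c' j * w j ^ m) + c j * w j ^ m" if "j < k" for j
      proof -
        have cj: "c j = c' j * (w j - w k)"
          using ne[OF that] that by (simp add: c'_def)
        have "c' j * w j ^ Suc m = w k * (c' j * w j ^ m) + (c' j * (w j - w k)) * w j ^ m"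
          by (simp add: algebra_simps)
        thus ?thesis by (simp only: cj[symmetric])
      qed
      have "poly (P (Suc m)) t = w k * poly (P m) t + poly (Q m) t"
        by (simp add: P_Suc w_def algebra_simps)
      also have "\<dots> = (\<Sum>j<k. w k * (c' j * w j ^ m) + c j * w j ^ m) + c' k * w k ^ Suc m"
        by (simp add: Suc c sum.distrib sum_distrib_left ring_distribs mult_ac)
      also have "\<dots> = (\<Sum>j<Suc k. c' j * w j ^ Suc m)"
        using * by simp
      finally show ?case .
    qed
    thus ?thesis by (auto simp: w_def)
  qed
  ultimately show ?case by blast
qed

lemma finite_noninjective_parameters:
  fixes u v :: "nat \<Rightarrow> 'a::field_char_0"
  assumes "inj v"
  shows "finite {t. \<not> inj_on (\<lambda>j. u j + t * v j) {..<k}}"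
proof (rule finite_subset)
  show "{t. \<not> inj_on (\<lambda>j. u j + t * v j) {..<k}} \<subseteq>
      (\<lambda>(i, j). (u j - u i) / (v i - v j)) ` ({..<k} \<times> {..<k})"
  proof
    fix t assume "t \<in> {t. \<not> inj_on (\<lambda>j. u j + t * v j) {..<k}}"
    then obtain i j where ij: "i < k" "j < k" "i \<noteq> j" "u i + t * v i = u j + t * v j"
      unfolding inj_on_def by auto
    have "v i - v j \<noteq> 0" using \<open>i \<noteq> j\<close> assms by (auto dest: injD)
    moreover have "t * (v i - v j) = u j - u i"
      using ij(4) by (simp add: algebra_simps)
    ultimately have "t = (u j - u i) / (v i - v j)"
      by (simp add: eq_divide_eq)
    thus "t \<in> (\<lambda>(i, j). (u j - u i) / (v i - v j)) ` ({..<k} \<times> {..<k})"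
      using ij by auto
  qed
qed auto

lemma monic_factorization:
  fixes g :: "'a::{alg_closed_field, field_char_0} poly"
  assumes "g \<noteq> 0"
  obtains u where "g = Polynomial.smult (lead_coeff g) (\<Prod>j<degree g. [:-u j, 1:])"
proof -
  obtain A where A: "size A = degree g"
    "g = Polynomial.smult (lead_coeff g) (\<Prod>x\<in>#A. [:-x, 1:])"
    using alg_closed_imp_factorization[OF assms] by blast
  obtain xs where xs: "A = mset xs" by (metis ex_mset)
  have "(\<Prod>x\<in>#A. [:-x, 1:]) = prod_list (map (\<lambda>x. [:-x, 1:]) xs)"
    by (simp add: xs flip: prod_mset_prod_list)
  also have "\<dots> = (\<Prod>j<length xs. [:-(xs ! j), 1:])"
    by (simp add: prod.list_conv_set_nth lessThan_atLeast0)
  finally show ?thesis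
    using A that[of "\<lambda>j. xs ! j"] xs by simp
qed

section \<open>Sums of powers and apolarity\<close>

text \<open>
  Vandermonde: at most $D + 1$ powers of degree \<open>D\<close> of pairwise nonproportional linear forms
  are linearly independent. Combining consecutive equations with the coefficients of the last point
  kills the last summand and lowers the degree.
\<close>

lemma weighted_powers_independent:
  fixes \<alpha> \<beta> :: "nat \<Rightarrow> 'a::field_char_0"
  assumes "\<And>m. m \<le> D \<Longrightarrow> (\<Sum>j<n. c j * \<alpha> j ^ (D - m) * \<beta> j ^ m) = 0"
    and "n \<le> Suc D"
    and "\<And>i j. i < j \<Longrightarrow> j < n \<Longrightarrow> \<alpha> j * \<beta> i - \<beta> j * \<alpha> i \<noteq> 0"
    and "\<And>j. j < n \<Longrightarrow> \<alpha> j \<noteq> 0 \<or> \<beta> j \<noteq> 0"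
    and "j < n"
  shows "c j = 0"
  using assms
proof (induction n arbitrary: c D j)
  case (Suc n)
  let ?S = "\<lambda>m. \<Sum>j<Suc n. c j * \<alpha> j ^ (D - m) * \<beta> j ^ m"
  have less: "c i = 0" if i: "i < n" for i
  proof -
    obtain D' where D: "D = Suc D'" using i Suc.prems(2) by (cases D) auto
    define c' where "c' j = c j * (\<alpha> n * \<beta> j - \<beta> n * \<alpha> j)" for j
    have "c' i = 0"
    proof (rule Suc.IH)
      fix m assume m: "m \<le> D'"
      have "(\<Sum>j<Suc n. c' j * \<alpha> j ^ (D' - m) * \<beta> j ^ m) = \<alpha> n * ?S (Suc m) - \<beta> n * ?S m"
        using m unfolding D
        by (simp add: c'_def Suc_diff_le sum_distrib_left ring_distribs
            sum_subtractf[symmetric] mult_ac del: sum.lessThan_Suc)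
      also have "\<dots> = 0"
        using m Suc.prems(1)[of m] Suc.prems(1)[of "Suc m"] by (simp add: D del: sum.lessThan_Suc)
      finally show "(\<Sum>j<n. c' j * \<alpha> j ^ (D' - m) * \<beta> j ^ m) = 0"
        by (simp add: c'_def)
    qed (use Suc.prems i D in auto)
    thus ?thesis using Suc.prems(3)[of i n] i by (auto simp: c'_def)
  qed
  have "c n = 0"
  proof (cases "\<alpha> n = 0")
    case True
    with Suc.prems(4)[of n] have "\<beta> n \<noteq> 0" by auto
    with Suc.prems(1)[of D] less show ?thesis by simp
  next
    case False
    with Suc.prems(1)[of 0] less show ?thesis by simp
  qed
  with less Suc.prems(5) show ?case by (auto simp: less_Suc_eq)
qed simp

lemma card_projective_roots_le:
  fixes g :: "'a::field_char_0 poly"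
  assumes "g \<noteq> 0" "degree g \<le> r"
    and zero: "\<And>j. j < n \<Longrightarrow> (\<Sum>l\<le>r. coeff g l * \<alpha> j ^ (r - l) * \<beta> j ^ l) = 0"
    and indep: "\<And>i j. i < j \<Longrightarrow> j < n \<Longrightarrow> \<alpha> j * \<beta> i - \<beta> j * \<alpha> i \<noteq> 0"
    and nz: "\<And>j. j < n \<Longrightarrow> \<alpha> j \<noteq> 0 \<or> \<beta> j \<noteq> 0"
  shows "n \<le> r"
proof -
  let ?A = "{j. j < n \<and> \<alpha> j \<noteq> 0}" and ?B = "{j. j < n \<and> \<alpha> j = 0}"
  have indep': "\<alpha> j * \<beta> i \<noteq> \<beta> j * \<alpha> i" if "i < n" "j < n" "i \<noteq> j" for i j
    using indep[of i j] indep[of j i] that by (cases i j rule: linorder_cases) (auto simp: mult_ac)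
  have root: "poly g (\<beta> j / \<alpha> j) = 0" if "j \<in> ?A" for j
  proof -
    have "\<alpha> j ^ r * poly g (\<beta> j / \<alpha> j) = (\<Sum>l\<le>r. \<alpha> j ^ r * (coeff g l * (\<beta> j / \<alpha> j) ^ l))"
      unfolding poly_altdef sum_distrib_left using assms(2)
      by (intro sum.mono_neutral_left) (auto simp: not_le intro: coeff_eq_0)
    also have "\<dots> = (\<Sum>l\<le>r. coeff g l * \<alpha> j ^ (r - l) * \<beta> j ^ l)"
      using that by (intro sum.cong refl) (simp add: power_diff power_divide field_simps)
    finally show ?thesis using zero[of j] that by simp
  qed
  have "inj_on (\<lambda>j. \<beta> j / \<alpha> j) ?A"
    by (intro inj_onI) (use indep' in \<open>auto simp: field_simps\<close>)
  hence "card ?A = card ((\<lambda>j. \<beta> j / \<alpha> j) ` ?A)"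
    by (simp add: card_image)
  also have "\<dots> \<le> card {x. poly g x = 0}"
    using root poly_roots_finite[OF assms(1)] by (intro card_mono) auto
  also have "\<dots> \<le> degree g"
    using card_poly_roots_bound[OF assms(1)] .
  finally have A: "card ?A \<le> degree g" .
  have "card ?A + card ?B \<le> r"
  proof (cases "?B = {}")
    case True
    with A assms(2) show ?thesis by (simp only: card.empty)
  next
    case False
    then obtain b where b: "b < n" "\<alpha> b = 0" by auto
    have "?B = {b}" using indep' b by force
    have "(\<Sum>l\<le>r. coeff g l * \<alpha> b ^ (r - l) * \<beta> b ^ l) = coeff g r * \<beta> b ^ r"
      using b by (subst sum.remove[of _ r]) (auto intro!: sum.neutral)
    with zero[OF b(1)] nz[OF b(1)] b(2) have "coeff g r = 0" by simp
    hence "degree g < r" using assms(1,2) by (metis le_neq_implies_less leading_coeff_0_iff)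
    thus ?thesis using A \<open>?B = {b}\<close> by simp
  qed
  moreover have "card ?A + card ?B = card (?A \<union> ?B)"
    by (intro card_Un_disjoint[symmetric]) auto
  moreover have "?A \<union> ?B = {..<n}" by auto
  ultimately show ?thesis by simp
qed

text \<open>
  Contracting $\sum_j L_j^d$ by \<open>g\<close> gives $\sum_j g(p_j) L_j^{d-r}$, up to a constant, where
  $p_j$ is the point of $L_j$. If there are at most $d - r + 1$ points, these powers are
  independent, so every $p_j$ is a root of \<open>g\<close>. This is what excludes all ranks strictly between
  \<open>r\<close> and $d - r + 2$.
\<close>

lemma apolar_imp_length_le:
  fixes \<alpha> \<beta> :: "nat \<Rightarrow> 'a::field_char_0"
  assumes "apolar d r a" "n + r \<le> Suc d" "r \<le> d"
    and a: "\<And>m. m \<le> d \<Longrightarrow> a m = (\<Sum>j<n. \<alpha> j ^ (d - m) * \<beta> j ^ m)"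
    and indep: "\<And>i j. i < j \<Longrightarrow> j < n \<Longrightarrow> \<alpha> j * \<beta> i - \<beta> j * \<alpha> i \<noteq> 0"
    and nz: "\<And>j. j < n \<Longrightarrow> \<alpha> j \<noteq> 0 \<or> \<beta> j \<noteq> 0"
  shows "n \<le> r"
proof -
  obtain g where g: "g \<noteq> 0" "degree g \<le> r" "\<And>m. m + r \<le> d \<Longrightarrow> contract g a m = 0"
    using assms(1) unfolding apolar_def by blast
  \<comment> \<open>The value at the \<open>j\<close>-th point of \<open>g\<close>, homogenised to degree \<open>r\<close>.\<close>
  define G where "G j = (\<Sum>l\<le>r. coeff g l * \<alpha> j ^ (r - l) * \<beta> j ^ l)" for j
  have "G j = 0" if "j < n" for j
  proof (rule weighted_powers_independent[where D = "d - r" and c = G, OF _ _ indep nz that])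
    fix m assume m: "m \<le> d - r"
    have "(\<Sum>j<n. G j * \<alpha> j ^ (d - r - m) * \<beta> j ^ m) =
        (\<Sum>j<n. \<Sum>l\<le>r. coeff g l * (\<alpha> j ^ (d - (l + m)) * \<beta> j ^ (l + m)))"
      unfolding G_def sum_distrib_right
    proof (intro sum.cong refl)
      fix j l assume l: "l \<in> {..r}"
      have "d - (l + m) = (r - l) + (d - r - m)" using l m assms(3) by auto
      thus "coeff g l * \<alpha> j ^ (r - l) * \<beta> j ^ l * \<alpha> j ^ (d - r - m) * \<beta> j ^ m =
          coeff g l * (\<alpha> j ^ (d - (l + m)) * \<beta> j ^ (l + m))"
        by (simp add: power_add mult_ac)
    qed
    also have "\<dots> = (\<Sum>l\<le>r. coeff g l * a (l + m))"
      using m assms(3) by (subst sum.swap) (simp add: a sum_distrib_left)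
    also have "\<dots> = contract g a m" by (simp add: contract_altdef[OF g(2)])
    also have "\<dots> = 0" using m assms(3) by (intro g(3)) auto
    finally show "(\<Sum>j<n. G j * \<alpha> j ^ (d - r - m) * \<beta> j ^ m) = 0" .
  qed (use assms(2,3) in auto)
  thus ?thesis
    unfolding G_def by (intro card_projective_roots_le[OF g(1,2) _ indep nz])
qed

section \<open>Linear functionals on polynomials\<close>

definition linear_functional :: "('a::field poly \<Rightarrow> 'a) \<Rightarrow> bool" where
  "linear_functional \<phi> \<longleftrightarrow> (\<forall>p q. \<phi> (p + q) = \<phi> p + \<phi> q) \<and>
    (\<forall>c p. \<phi> (Polynomial.smult c p) = c * \<phi> p)"

definition poly_subspace :: "'a::field poly set \<Rightarrow> bool" where
  "poly_subspace V \<longleftrightarrow> (\<forall>p\<in>V. \<forall>q\<in>V. p + q \<in> V) \<and>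
    (\<forall>c. \<forall>p\<in>V. Polynomial.smult c p \<in> V)"

text \<open>
  The duality between subspaces and spans of functionals. It provides all the linear algebra used
  below, namely the multipliers in the base point argument and the left inverse of an injective
  Hankel matrix.
\<close>

lemma functional_in_span:
  fixes \<phi> :: "'a::field poly \<Rightarrow> 'a" and \<psi> :: "nat \<Rightarrow> 'a poly \<Rightarrow> 'a"
  assumes "poly_subspace V" "linear_functional \<phi>" "\<And>m. m < n \<Longrightarrow> linear_functional (\<psi> m)"
    and "\<And>p. p \<in> V \<Longrightarrow> (\<And>m. m < n \<Longrightarrow> \<psi> m p = 0) \<Longrightarrow> \<phi> p = 0"
  shows "\<exists>c. \<forall>p\<in>V. \<phi> p = (\<Sum>m<n. c m * \<psi> m p)"
  using assms
proof (induction n arbitrary: V)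
  case (Suc n)
  define V' where "V' = {p \<in> V. \<psi> n p = 0}"
  have lin_n: "\<psi> n (p + q) = \<psi> n p + \<psi> n q" "\<psi> n (Polynomial.smult s p) = s * \<psi> n p" for p q s
    using Suc.prems(3)[of n] by (auto simp: linear_functional_def)
  have "poly_subspace V'"
    using Suc.prems(1) lin_n by (auto simp: V'_def poly_subspace_def)
  moreover have "\<phi> p = 0" if "p \<in> V'" "\<And>m. m < n \<Longrightarrow> \<psi> m p = 0" for p
    using that Suc.prems(4)[of p] by (auto simp: V'_def less_Suc_eq)
  ultimately obtain c where c: "\<And>p. p \<in> V' \<Longrightarrow> \<phi> p = (\<Sum>m<n. c m * \<psi> m p)"
    using Suc.IH[of V'] Suc.prems(2,3) by (meson less_SucI)
  define \<chi> where "\<chi> p = \<phi> p - (\<Sum>m<n. c m * \<psi> m p)" for p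
  have \<chi>_add: "\<chi> (p + q) = \<chi> p + \<chi> q" for p q
    using Suc.prems(2,3)
    by (simp add: \<chi>_def linear_functional_def sum.distrib distrib_left)
  have \<chi>_smult: "\<chi> (Polynomial.smult s p) = s * \<chi> p" for s p
  proof -
    have "(\<Sum>m<n. c m * \<psi> m (Polynomial.smult s p)) = s * (\<Sum>m<n. c m * \<psi> m p)"
      unfolding sum_distrib_left
      by (intro sum.cong refl) (use Suc.prems(3) in \<open>simp add: linear_functional_def\<close>)
    thus ?thesis
      using Suc.prems(2) by (simp add: \<chi>_def linear_functional_def right_diff_distrib)
  qed
  have "\<exists>e. \<forall>p\<in>V. \<chi> p = e * \<psi> n p"
  proof (cases "\<exists>w\<in>V. \<psi> n w \<noteq> 0")
    case True
    then obtain w where w: "w \<in> V" "\<psi> n w \<noteq> 0" by blast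
    have "\<chi> p = \<chi> w / \<psi> n w * \<psi> n p" if "p \<in> V" for p
    proof -
      define p' where "p' = p + Polynomial.smult (- \<psi> n p / \<psi> n w) w"
      have "p' \<in> V"
      proof -
        have "Polynomial.smult (- \<psi> n p / \<psi> n w) w \<in> V"
          using Suc.prems(1) w(1) by (simp only: poly_subspace_def)
        thus ?thesis
          using Suc.prems(1) that by (simp only: p'_def poly_subspace_def)
      qed
      moreover have "\<psi> n p' = 0"
        using w(2) by (simp only: p'_def lin_n) simp
      ultimately have "p' \<in> V'" by (simp add: V'_def)
      hence "\<chi> p' = 0" using c by (simp add: \<chi>_def)
      hence "\<chi> p + - \<psi> n p / \<psi> n w * \<chi> w = 0"
        by (simp only: p'_def \<chi>_add \<chi>_smult)
      thus ?thesis by (simp add: mult.commute)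
    qed
    thus ?thesis by blast
  next
    case False
    hence "\<chi> p = 0" if "p \<in> V" for p
      using c[of p] that by (auto simp: \<chi>_def V'_def)
    thus ?thesis by (intro exI[of _ 0]) simp
  qed
  then obtain e where e: "\<And>p. p \<in> V \<Longrightarrow> \<chi> p = e * \<psi> n p" by blast
  have "\<phi> p = (\<Sum>m<Suc n. (if m < n then c m else e) * \<psi> m p)" if "p \<in> V" for p
    using e[OF that] by (simp add: \<chi>_def algebra_simps)
  thus ?case by (intro exI[of _ "\<lambda>m. if m < n then c m else e"]) blast
qed simp

lemma linear_functional_contract: "linear_functional (\<lambda>p. contract p a m)"
  by (simp add: linear_functional_def contract_add contract_smult)

lemma poly_subspace_degree_le: "poly_subspace {p. degree p \<le> n}"
  by (auto simp: poly_subspace_def intro: degree_add_le order_trans[OF degree_smult_le])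

section \<open>Squarefree members of a base point free linear system\<close>

text \<open>
  Each point of \<open>U\<close> excludes a proper subspace, and a vector space over an infinite field is not
  a finite union of proper subspaces.
\<close>

lemma ex_nonvanishing_member:
  fixes W :: "'a::field_char_0 poly set"
  assumes W: "poly_subspace W" "W \<noteq> {}" and bpf: "\<And>u. \<exists>p\<in>W. poly p u \<noteq> 0" and "finite U"
  shows "\<exists>h\<in>W. \<forall>u\<in>U. poly h u \<noteq> 0"
  using \<open>finite U\<close>
proof (induction U rule: finite_induct)
  case (insert u U)
  then obtain h where h: "h \<in> W" "\<And>v. v \<in> U \<Longrightarrow> poly h v \<noteq> 0" by blast
  obtain p where p: "p \<in> W" "poly p u \<noteq> 0" using bpf by blast
  have "finite ((\<lambda>v. - poly h v / poly p v) ` insert u U)"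
    using insert.hyps by simp
  then obtain t where t: "t \<notin> (\<lambda>v. - poly h v / poly p v) ` insert u U"
    using ex_new_if_finite[OF infinite_UNIV_char_0] by blast
  have "poly (h + Polynomial.smult t p) v \<noteq> 0" if v: "v \<in> insert u U" for v
  proof (cases "poly p v = 0")
    case True
    with p v h show ?thesis by auto
  next
    case False
    have "t \<noteq> - poly h v / poly p v" using t v by blast
    with False have "t * poly p v \<noteq> - poly h v"
      by (subst (asm) nonzero_eq_divide_eq)
    thus ?thesis by (simp add: add_eq_0_iff)
  qed
  moreover have "h + Polynomial.smult t p \<in> W"
    using W(1) h(1) p(1) by (auto simp: poly_subspace_def)
  ultimately show ?case by blast
qed (use W in auto)

text \<open>
  At a root of \<open>w\<close> the order of vanishing of $w h'$ is larger than that of $w' h$, because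
  differentiation lowers the multiplicity of a root in characteristic zero.
\<close>

lemma wronskian_nonzero:
  fixes w h :: "'a::{alg_closed_field, field_char_0} poly"
  assumes "degree w \<ge> 1" "\<And>z. poly w z = 0 \<Longrightarrow> poly h z \<noteq> 0"
  shows "w * pderiv h - pderiv w * h \<noteq> 0"
proof
  assume eq: "w * pderiv h - pderiv w * h = 0"
  obtain z where z: "poly w z = 0"
    using alg_closed_imp_poly_has_root[of w] assms(1) by auto
  have w': "pderiv w \<noteq> 0" using assms(1) by (simp add: pderiv_eq_0_iff)
  have "w \<noteq> 0" using assms(1) by auto
  have hz: "poly h z \<noteq> 0" using assms(2) z by blast
  hence "h \<noteq> 0" by auto
  with w' eq have "w * pderiv h \<noteq> 0" by auto
  hence "order z w \<le> order z (w * pderiv h)"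
    by (simp add: order_mult)
  also have "w * pderiv h = pderiv w * h" using eq by simp
  also have "order z (pderiv w * h) = order z (pderiv w)"
    using w' \<open>h \<noteq> 0\<close> hz by (simp add: order_mult order_0I)
  also have "\<dots> < order z w"
    using order_pderiv[OF \<open>w \<noteq> 0\<close>, of z] z \<open>w \<noteq> 0\<close> by (simp add: order_root)
  finally show False by simp
qed

text \<open>
  Bertini's theorem for the projective line. In a pencil $w + t h$ without common roots, a double
  root of a member is a root of the Wronskian of \<open>w\<close> and \<open>h\<close>, and at each such point at most
  one value of \<open>t\<close> is bad. Asking for the exact degree \<open>e\<close> means that infinity is not a root.
\<close>

lemma ex_squarefree_member:
  fixes W :: "'a::{alg_closed_field, field_char_0} poly set"
  assumes W: "poly_subspace W" "\<And>p. p \<in> W \<Longrightarrow> degree p \<le> e" and "e \<ge> 1"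
    and bpf: "\<And>u. \<exists>p\<in>W. poly p u \<noteq> 0" and bpf_infinity: "\<exists>p\<in>W. coeff p e \<noteq> 0"
  shows "\<exists>f\<in>W. degree f = e \<and> (\<forall>z. poly f z = 0 \<longrightarrow> poly (pderiv f) z \<noteq> 0)"
proof -
  obtain w where w: "w \<in> W" "coeff w e \<noteq> 0" using bpf_infinity by blast
  have deg_w: "degree w = e" using W(2)[OF w(1)] w(2) by (simp add: le_antisym le_degree)
  hence "w \<noteq> 0" using \<open>e \<ge> 1\<close> by auto
  obtain h where h: "h \<in> W" "\<And>z. poly w z = 0 \<Longrightarrow> poly h z \<noteq> 0"
    using ex_nonvanishing_member[OF W(1) _ bpf, of "{z. poly w z = 0}"] w(1)
      poly_roots_finite[OF \<open>w \<noteq> 0\<close>] by blast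
  \<comment> \<open>The parameters for which the degree drops or a double root appears.\<close>
  define B where "B = insert (- coeff w e / coeff h e)
    ((\<lambda>z. - poly w z / poly h z) ` {z. poly (w * pderiv h - pderiv w * h) z = 0})"
  have "w * pderiv h - pderiv w * h \<noteq> 0"
    using deg_w \<open>e \<ge> 1\<close> h(2) by (intro wronskian_nonzero) auto
  hence "finite B" unfolding B_def by (intro finite.insertI finite_imageI poly_roots_finite)
  then obtain t where t: "t \<notin> B"
    using ex_new_if_finite[OF infinite_UNIV_char_0] by blast
  define f where "f = w + Polynomial.smult t h"
  have "f \<in> W" using W(1) w(1) h(1) by (auto simp: f_def poly_subspace_def)
  have "coeff f e \<noteq> 0"
  proof (cases "coeff h e = 0")
    case False
    moreover have "t \<noteq> - coeff w e / coeff h e" using t by (auto simp: B_def)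
    ultimately have "t * coeff h e \<noteq> - coeff w e"
      by (subst (asm) nonzero_eq_divide_eq)
    thus ?thesis by (simp add: f_def add_eq_0_iff)
  qed (simp add: f_def w)
  hence "degree f = e" using W(2)[OF \<open>f \<in> W\<close>] by (simp add: le_antisym le_degree)
  moreover have False if z: "poly f z = 0" "poly (pderiv f) z = 0" for z
  proof -
    have wz: "poly w z = - t * poly h z" "poly (pderiv w) z = - t * poly (pderiv h) z"
      using z by (simp_all add: f_def pderiv_add pderiv_smult add_eq_0_iff2)
    hence "poly (w * pderiv h - pderiv w * h) z = 0" by simp
    moreover have "poly h z \<noteq> 0" using h(2) wz by auto
    hence "t = - poly w z / poly h z" using wz by simp
    ultimately show False using t by (auto simp: B_def)
  qed
  ultimately show ?thesis using \<open>f \<in> W\<close> by blast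
qed

section \<open>Forms without an apolar form of small degree\<close>

lemma power_sum_of_squarefree:
  fixes a :: "nat \<Rightarrow> 'a::{alg_closed_field, field_char_0}"
  assumes "d \<ge> 1" "f \<noteq> 0" "Suc d = r + degree f"
    and simple: "\<And>z. poly f z = 0 \<Longrightarrow> poly (pderiv f) z \<noteq> 0"
    and f: "\<And>m. m < r \<Longrightarrow> contract f a m = 0"
  shows "power_sum d (degree f) a"
proof -
  define e where "e = degree f"
  obtain u where u: "f = Polynomial.smult (lead_coeff f) (\<Prod>j<e. [:-u j, 1:])"
    using monic_factorization[OF assms(2)] unfolding e_def by blast
  have inj: "inj_on u {..<e}"
  proof (rule inj_onI, rule ccontr)
    fix i j assume ij: "i \<in> {..<e}" "j \<in> {..<e}" "u i = u j" "i \<noteq> j"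
    define R where "R = Polynomial.smult (lead_coeff f) (\<Prod>l\<in>{..<e} - {i} - {j}. [:-u l, 1:])"
    have "(\<Prod>l<e. [:-u l, 1:]) = [:-u i, 1:] * ([:-u j, 1:] * (\<Prod>l\<in>{..<e} - {i} - {j}. [:-u l, 1:]))"
      using ij by (subst prod.remove[of _ i], simp, simp, subst prod.remove[of _ j]) auto
    hence fR: "f = [:-u i, 1:] * ([:-u i, 1:] * R)"
      by (subst u) (simp only: R_def ij(3) mult_smult_right)
    have "poly f (u i) = 0" by (subst fR) simp
    moreover have "poly (pderiv f) (u i) = 0"
      by (subst fR) (simp only: pderiv_mult poly_add poly_mult, simp)
    ultimately show False using simple by blast
  qed
  have "contract (\<Prod>j<e. [:-u j, 1:]) a m = 0" if "m < r" for m
    using f[OF that] assms(2) by (subst (asm) u) (simp add: contract_smult)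
  from recurrence_deformation[of r u e a "\<lambda>_. 0", OF this]
  obtain P where P: "\<And>m. m < r + e \<Longrightarrow> poly (P m) 0 = a m"
    and "\<forall>t. inj_on (\<lambda>j. u j + t * 0) {..<e} \<longrightarrow>
      (\<exists>c. \<forall>m. poly (P m) t = (\<Sum>j<e. c j * (u j + t * 0) ^ m))"
    by blast
  then obtain c where c: "\<And>m. poly (P m) 0 = (\<Sum>j<e. c j * u j ^ m)"
    using inj by fastforce
  have "power_sum d (card {..<e}) a"
  proof (rule weighted_power_sumI[OF assms(1)])
    fix m assume "m \<le> d"
    thus "a m = (\<Sum>j<e. c j * 1 ^ (d - m) * u j ^ m)"
      using P[of m] c[of m] assms(3) by (simp add: e_def)
  qed simp
  thus ?thesis by (simp add: e_def)
qed

text \<open>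
  By duality the functional is a combination of the \<open>r\<close> equations that define the space of
  apolar polynomials; the coefficients of the combination are collected in the polynomial \<open>H\<close>.
\<close>

lemma functional_by_multiplier:
  assumes "linear_functional \<phi>"
    and "\<And>p. degree p \<le> e \<Longrightarrow> (\<And>m. m < r \<Longrightarrow> contract p a m = 0) \<Longrightarrow> \<phi> p = 0"
  shows "\<exists>H. (H = 0 \<or> degree H < r) \<and> (\<forall>p. degree p \<le> e \<longrightarrow> \<phi> p = contract (H * p) a 0)"
proof -
  have "\<exists>c. \<forall>p\<in>{p. degree p \<le> e}. \<phi> p = (\<Sum>m<r. c m * contract p a m)"
    using assms
    by (intro functional_in_span poly_subspace_degree_le linear_functional_contract) auto
  then obtain c where c: "\<And>p. degree p \<le> e \<Longrightarrow> \<phi> p = (\<Sum>m<r. c m * contract p a m)"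
    by blast
  define H where "H = (\<Sum>m<r. monom (c m) m)"
  have "contract H b 0 = (\<Sum>m<k. c m * b m)" if "H = (\<Sum>m<k. monom (c m) m)" for b k H
    using that by (induction k arbitrary: H) (auto simp: contract_add contract_monom)
  hence "contract (H * p) a 0 = (\<Sum>m<r. c m * contract p a m)" for p
    by (simp add: contract_mult H_def)
  moreover have "H = 0 \<or> degree H < r"
  proof (cases "r = 0")
    case False
    have "degree (monom (c m) m) \<le> r - 1" if "m < r" for m
      using degree_monom_le[of "c m" m] that by linarith
    hence "degree H \<le> r - 1"
      unfolding H_def by (intro degree_sum_le) auto
    thus ?thesis using False by linarith
  qed (simp add: H_def)
  ultimately show ?thesis using c by auto
qed

lemma contract_mult_monom: "contract (p * monom 1 m) a 0 = contract p a m"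
  by (simp add: contract_mult' contract_monom)

text \<open>
  The apolar polynomials of degree at most $e = d - r + 1$ have no common root: if all of them
  vanished at \<open>u\<close>, evaluation at \<open>u\<close> would be given by a multiplier \<open>H\<close> of degree less than
  \<open>r\<close>, and then $(T - u) H$, or \<open>H\<close> itself when $u = \infty$, would be apolar of degree at most
  \<open>r\<close>. By Bertini there is a squarefree one of degree \<open>e\<close>, which gives \<open>e\<close> summands.
\<close>

lemma not_apolar_imp_power_sum:
  fixes a :: "nat \<Rightarrow> 'a::{alg_closed_field, field_char_0}"
  assumes "\<not> apolar d r a" "1 \<le> r" "r \<le> d"
  shows "power_sum d (Suc d - r) a"
proof -
  define e where "e = Suc d - r"
  have e: "e \<ge> 1" "Suc d = r + e" using assms(3) by (auto simp: e_def)
  define W where "W = {p. degree p \<le> e \<and> (\<forall>m<r. contract p a m = 0)}"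
  have "poly_subspace W"
    by (auto simp: W_def poly_subspace_def contract_add contract_smult
        intro: degree_add_le order_trans[OF degree_smult_le])
  moreover have "\<exists>p\<in>W. poly p u \<noteq> 0" for u
  proof (rule ccontr)
    assume neg: "\<not> ?thesis"
    have "\<exists>H. (H = 0 \<or> degree H < r) \<and>
        (\<forall>p. degree p \<le> e \<longrightarrow> poly p u = contract (H * p) a 0)"
      by (intro functional_by_multiplier) (use neg in \<open>auto simp: linear_functional_def W_def\<close>)
    then obtain H where H: "H = 0 \<or> degree H < r"
      "\<And>p. degree p \<le> e \<Longrightarrow> poly p u = contract (H * p) a 0" by blast
    have "H \<noteq> 0" using H(2)[of 1] by auto
    have "contract (H * [:-u, 1:]) a m = 0" if "m + r \<le> d" for m
    proof -
      have "degree ([:-u, 1:] * monom 1 m) \<le> e"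
        using degree_mult_le[of "[:-u, 1:]" "monom 1 m"] that e(2) by (simp add: degree_monom_eq)
      from H(2)[OF this] have "contract (H * [:-u, 1:] * monom 1 m) a 0 = 0"
        by (simp only: mult.assoc poly_mult) simp
      thus ?thesis by (simp only: contract_mult_monom)
    qed
    moreover have "degree (H * [:-u, 1:]) \<le> r"
      using degree_mult_le[of H "[:-u, 1:]"] H(1) \<open>H \<noteq> 0\<close> by simp
    moreover have "H * [:-u, 1:] \<noteq> 0"
      using \<open>H \<noteq> 0\<close> by (metis mult_eq_0_iff pCons_eq_0_iff zero_neq_one)
    ultimately show False using assms(1) unfolding apolar_def by blast
  qed
  moreover have "\<exists>p\<in>W. coeff p e \<noteq> 0"
  proof (rule ccontr)
    assume neg: "\<not> ?thesis"
    have "\<exists>H. (H = 0 \<or> degree H < r) \<and>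
        (\<forall>p. degree p \<le> e \<longrightarrow> coeff p e = contract (H * p) a 0)"
      by (intro functional_by_multiplier) (use neg in \<open>auto simp: linear_functional_def W_def\<close>)
    then obtain H where H: "H = 0 \<or> degree H < r"
      "\<And>p. degree p \<le> e \<Longrightarrow> coeff p e = contract (H * p) a 0" by blast
    have "H \<noteq> 0" using H(2)[of "monom 1 e"] by (auto simp: degree_monom_eq)
    have "contract H a m = 0" if "m + r \<le> d" for m
    proof -
      have "contract (H * monom 1 m) a 0 = coeff (monom 1 m) e"
        using that e(2) by (intro H(2)[symmetric]) (simp add: degree_monom_eq)
      thus ?thesis using that e(2) by (simp add: contract_mult_monom coeff_monom)
    qed
    moreover have "degree H \<le> r" using H(1) \<open>H \<noteq> 0\<close> by simp
    ultimately show False using assms(1) \<open>H \<noteq> 0\<close> unfolding apolar_def by blast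
  qed
  ultimately obtain f where f: "f \<in> W" "degree f = e"
    "\<And>z. poly f z = 0 \<Longrightarrow> poly (pderiv f) z \<noteq> 0"
    using ex_squarefree_member[of W e] e(1) unfolding W_def by blast
  have "power_sum d (degree f) a"
    using f e assms by (intro power_sum_of_squarefree[where r = r]) (auto simp: W_def)
  thus ?thesis using f(2) by (simp add: e_def)
qed

section \<open>Apolarity as a limit of sums of powers\<close>

text \<open>
  The annihilating form has \<open>k\<close> finite roots and $n = r - k$ roots at infinity. The solution
  \<open>P\<close> of the recurrence belonging to the finite roots agrees with \<open>a\<close> except for the last \<open>n\<close>
  entries; the difference, read backwards, is killed by $T^n$, that is, by \<open>n\<close> roots at $0$.
  Both parts are deformed separately, with root velocities $0, 1, 2, \dots$.
\<close>

lemma apolar_deformation: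
  fixes a :: "nat \<Rightarrow> 'a::{alg_closed_field, field_char_0}"
  assumes "apolar d r a" "1 \<le> r" "r \<le> d"
  obtains P u k where "\<And>m. m \<le> d \<Longrightarrow> poly (P m) 0 = a m" "k \<le> r"
    "\<And>t. inj_on (\<lambda>j. u j + t * of_nat j) {..<k} \<Longrightarrow> inj_on (\<lambda>j. t * of_nat j) {..<r - k} \<Longrightarrow>
      power_sum d r (\<lambda>m. poly (P m) t)"
proof -
  have "d \<ge> 1" using assms by simp
  obtain g where g: "g \<noteq> 0" "degree g \<le> r" "\<And>m. m + r \<le> d \<Longrightarrow> contract g a m = 0"
    using assms(1) unfolding apolar_def by blast
  define k where "k = degree g"
  define n where "n = r - k"
  have kn: "k \<le> r" "n \<le> d" "r = k + n" using g(2) assms(3) by (auto simp: k_def n_def)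
  obtain u where u: "g = Polynomial.smult (lead_coeff g) (\<Prod>j<k. [:-u j, 1:])"
    using monic_factorization[OF g(1)] unfolding k_def by blast
  have "contract (\<Prod>j<k. [:-u j, 1:]) a m = 0" if "m < Suc d - r" for m
  proof -
    have "contract g a m = 0" using that by (intro g(3)) simp
    thus ?thesis using g(1) by (subst (asm) u) (simp add: contract_smult)
  qed
  from recurrence_deformation[of "Suc d - r" u k a of_nat, OF this]
  obtain P where P: "\<And>m. m < Suc d - r + k \<Longrightarrow> poly (P m) 0 = a m"
    and Pt: "\<And>t. inj_on (\<lambda>j. u j + t * of_nat j) {..<k} \<Longrightarrow>
      \<exists>c. \<forall>m. poly (P m) t = (\<Sum>j<k. c j * (u j + t * of_nat j) ^ m)"
    by blast
  define b where "b m = (if m < n then a (d - m) - poly (P (d - m)) 0 else 0)" for m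
  have "contract (\<Prod>j<n. [:-0, 1:]) b m = 0" for m
  proof -
    have "(\<Prod>j<n. [:-0, 1:]) = (monom 1 n :: 'a poly)"
      by (simp add: monom_altdef)
    thus ?thesis by (simp add: contract_monom b_def)
  qed
  from recurrence_deformation[of "Suc d" "\<lambda>_. 0" n b of_nat, OF this]
  obtain Q where Q: "\<And>m. m < Suc d + n \<Longrightarrow> poly (Q m) 0 = b m"
    and Qt: "\<And>t. inj_on (\<lambda>j. t * of_nat j) {..<n} \<Longrightarrow>
      \<exists>c. \<forall>m. poly (Q m) t = (\<Sum>j<n. c j * (t * of_nat j) ^ m)"
    by auto
  show thesis
  proof (rule that[where P = "\<lambda>m. P m + Q (d - m)" and u = u and k = k])
    show "poly (P m + Q (d - m)) 0 = a m" if "m \<le> d" for m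
      using that P[of m] Q[of "d - m"] kn assms(3) by (auto simp: b_def)
    show "k \<le> r" by fact
    fix t :: 'a
    assume t: "inj_on (\<lambda>j. u j + t * of_nat j) {..<k}" "inj_on (\<lambda>j. t * of_nat j) {..<r - k}"
    obtain c where c: "\<And>m. poly (P m) t = (\<Sum>j<k. c j * (u j + t * of_nat j) ^ m)"
      using Pt[OF t(1)] by blast
    obtain c' where c': "\<And>m. poly (Q m) t = (\<Sum>j<n. c' j * (t * of_nat j) ^ m)"
      using Qt[OF t(2)[folded n_def]] by blast
    have "power_sum d (card {..<k}) (\<lambda>m. poly (P m) t)"
      by (rule weighted_power_sumI[where \<alpha> = "\<lambda>_. 1"]) (use \<open>d \<ge> 1\<close> c in auto)
    moreover have "power_sum d (card {..<n}) (\<lambda>m. poly (Q m) t)"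
      by (rule weighted_power_sumI[where \<alpha> = "\<lambda>_. 1"]) (use \<open>d \<ge> 1\<close> c' in auto)
    ultimately show "power_sum d r (\<lambda>m. poly (P m + Q (d - m)) t)"
      using power_sum_add[OF _ power_sum_rev] kn(3) by fastforce
  qed
qed

text \<open>
  A single root is trivially distinct from the others, so the deformation decomposes already at
  $t = 0$.
\<close>

lemma apolar_1_imp_power_sum:
  fixes a :: "nat \<Rightarrow> 'a::{alg_closed_field, field_char_0}"
  assumes "apolar d 1 a" "d \<ge> 1"
  shows "power_sum d 1 a"
proof -
  obtain P u k where P: "\<And>m. m \<le> d \<Longrightarrow> poly (P m) 0 = a m" "k \<le> 1"
    "\<And>t. inj_on (\<lambda>j. u j + t * of_nat j) {..<k} \<Longrightarrow> inj_on (\<lambda>j. t * of_nat j) {..<1 - k} \<Longrightarrow>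
      power_sum d 1 (\<lambda>m. poly (P m) t)"
    by (rule apolar_deformation[OF assms(1) le_refl assms(2)]) (rule that)
  have "power_sum d 1 (\<lambda>m. poly (P m) 0)"
    using P(2) by (intro P(3)) (auto simp: inj_on_def)
  thus ?thesis using P(1) by (simp add: power_sum_def)
qed

section \<open>Rank and apolarity\<close>

lemma power_sum_cong:
  "(\<And>m. m \<le> d \<Longrightarrow> a m = b m) \<Longrightarrow> power_sum d n a \<longleftrightarrow> power_sum d n b"
  by (simp add: power_sum_def)

lemma power_sum_mono:
  assumes "power_sum d n a" "n \<le> k" "d \<ge> 1"
  shows "power_sum d k a"
proof -
  have "power_sum d (k - n) (\<lambda>_. 0 :: 'a)"
    unfolding power_sum_def using assms(3)
    by (intro exI[of _ "\<lambda>_. 0"]) (auto simp: power_0_left)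
  from power_sum_add[OF assms(1) this] show ?thesis using assms(2) by simp
qed

lemma power_sum_imp_apolar:
  assumes "power_sum d n a" "n \<le> d"
  shows "apolar d n a"
proof -
  obtain \<alpha> \<beta> where "\<And>m. m \<le> d \<Longrightarrow> a m = (\<Sum>j<n. \<alpha> j ^ (d - m) * \<beta> j ^ m)"
    using assms(1) unfolding power_sum_def by blast
  thus ?thesis
    using assms(2) by (intro apolar_of_weighted_sum[where c = "\<lambda>_. 1"]) auto
qed

text \<open>
  Powers of proportional linear forms combine into one, so a shortest decomposition uses pairwise
  nonproportional forms.
\<close>

lemma power_sum_merge:
  fixes a :: "nat \<Rightarrow> 'a::{alg_closed_field, field_char_0}"
  assumes "d \<ge> 1" and a: "\<And>m. m \<le> d \<Longrightarrow> a m = (\<Sum>j<n. \<alpha> j ^ (d - m) * \<beta> j ^ m)"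
    and ij: "i < j" "j < n" "\<alpha> j * \<beta> i - \<beta> j * \<alpha> i = 0"
  shows "power_sum d (n - 1) a"
proof -
  have "\<exists>\<gamma> \<delta> s t. \<alpha> i = s * \<gamma> \<and> \<beta> i = s * \<delta> \<and> \<alpha> j = t * \<gamma> \<and> \<beta> j = t * \<delta>"
  proof (cases "\<alpha> i = 0 \<and> \<beta> i = 0")
    case True
    thus ?thesis by (intro exI[of _ "\<alpha> j"] exI[of _ "\<beta> j"] exI[of _ 0] exI[of _ 1]) simp
  next
    case False
    have "\<exists>t. \<alpha> j = t * \<alpha> i \<and> \<beta> j = t * \<beta> i"
    proof (cases "\<alpha> i = 0")
      case True
      with False ij(3) show ?thesis by (intro exI[of _ "\<beta> j / \<beta> i"]) auto
    next
      case False
      with ij(3) show ?thesis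
        by (intro exI[of _ "\<alpha> j / \<alpha> i"]) (simp add: field_simps)
    qed
    thus ?thesis by (metis mult_1)
  qed
  then obtain \<gamma> \<delta> s t where st: "\<alpha> i = s * \<gamma>" "\<beta> i = s * \<delta>" "\<alpha> j = t * \<gamma>" "\<beta> j = t * \<delta>"
    by blast
  define c where "c l = (if l = i then s ^ d + t ^ d else 1)" for l
  have "power_sum d (card ({..<n} - {j})) a"
  proof (rule weighted_power_sumI[where c = c and \<alpha> = "\<alpha>(i := \<gamma>)" and \<beta> = "\<beta>(i := \<delta>)"])
    fix m assume m: "m \<le> d"
    have *: "(x * \<gamma>) ^ (d - m) * (x * \<delta>) ^ m = x ^ d * (\<gamma> ^ (d - m) * \<delta> ^ m)" for x
      using power_add[of x "d - m" m] m by (simp add: power_mult_distrib mult_ac)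
    have i: "i \<in> {..<n} - {j}" using ij by auto
    have "a m = \<alpha> j ^ (d - m) * \<beta> j ^ m + (\<alpha> i ^ (d - m) * \<beta> i ^ m +
        (\<Sum>l\<in>{..<n} - {j} - {i}. \<alpha> l ^ (d - m) * \<beta> l ^ m))"
      using i ij by (simp add: a[OF m] sum.remove[of "{..<n}" j] sum.remove[of "{..<n} - {j}" i])
    also have "\<dots> = (s ^ d + t ^ d) * \<gamma> ^ (d - m) * \<delta> ^ m +
        (\<Sum>l\<in>{..<n} - {j} - {i}. \<alpha> l ^ (d - m) * \<beta> l ^ m)"
      by (simp only: st *) (simp add: algebra_simps)
    also have "\<dots> = (\<Sum>l\<in>{..<n} - {j}. c l * (\<alpha>(i := \<gamma>)) l ^ (d - m) * (\<beta>(i := \<delta>)) l ^ m)"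
      using i by (subst sum.remove[of "{..<n} - {j}" i]) (auto simp: c_def intro!: sum.cong)
    finally show "a m = \<dots>" .
  qed (use assms(1) in auto)
  thus ?thesis using ij(2) by simp
qed

context
  fixes d :: nat and q :: "'a::{alg_closed_field, field_char_0} poly poly"
  assumes d: "d \<ge> 1" and q: "q \<in> binary_forms d"
begin

lemma power_sum_degree: "power_sum d d (dual_coeff d q)"
proof (cases "apolar d 1 (dual_coeff d q)")
  case True
  thus ?thesis using apolar_1_imp_power_sum power_sum_mono d by blast
next
  case False
  thus ?thesis using not_apolar_imp_power_sum[of d 1] d by simp
qed

lemma form_rank_attained: "form_rank d q \<ge> 1 \<and> power_sum d (form_rank d q) (dual_coeff d q)"
  unfolding form_rank_eq[OF q]
  by (rule LeastI[of "\<lambda>n. n \<ge> 1 \<and> power_sum d n (dual_coeff d q)"])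
     (use d power_sum_degree in auto)

lemma form_rank_ge_1: "form_rank d q \<ge> 1"
  using form_rank_attained by blast

lemma form_rank_le_iff:
  assumes "r \<ge> 1"
  shows "form_rank d q \<le> r \<longleftrightarrow> power_sum d r (dual_coeff d q)"
proof
  assume "form_rank d q \<le> r"
  thus "power_sum d r (dual_coeff d q)"
    using form_rank_attained power_sum_mono d by blast
next
  assume "power_sum d r (dual_coeff d q)"
  thus "form_rank d q \<le> r"
    unfolding form_rank_eq[OF q]
    by (intro Least_le[of "\<lambda>n. n \<ge> 1 \<and> power_sum d n (dual_coeff d q)"] conjI assms)
qed

lemma form_rank_le: "form_rank d q \<le> d"
  using form_rank_le_iff[OF d] power_sum_degree by blast

text \<open>
  The right-hand side of the theorem is thus the locus of forms with an apolar form of degree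
  \<open>r\<close>.
\<close>

lemma apolar_iff_form_rank:
  assumes "1 \<le> r" "r \<le> d"
  shows "apolar d r (dual_coeff d q) \<longleftrightarrow> form_rank d q \<le> r \<or> d - r + 2 \<le> form_rank d q"
proof
  assume ap: "apolar d r (dual_coeff d q)"
  define n where "n = form_rank d q"
  show "form_rank d q \<le> r \<or> d - r + 2 \<le> form_rank d q"
  proof (rule ccontr)
    assume "\<not> ?thesis"
    hence n: "r < n" "n + r \<le> Suc d" using assms by (auto simp: n_def)
    hence "power_sum d n (dual_coeff d q)"
      using form_rank_le_iff[of n] assms(1) by (simp add: n_def)
    then obtain \<alpha> \<beta> where
      ab: "\<And>m. m \<le> d \<Longrightarrow> dual_coeff d q m = (\<Sum>j<n. \<alpha> j ^ (d - m) * \<beta> j ^ m)"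
      unfolding power_sum_def by blast
    have indep: "\<alpha> j * \<beta> i - \<beta> j * \<alpha> i \<noteq> 0" if "i < j" "j < n" for i j
    proof
      assume "\<alpha> j * \<beta> i - \<beta> j * \<alpha> i = 0"
      hence "power_sum d (n - 1) (dual_coeff d q)"
        using power_sum_merge[OF d ab that] by blast
      hence "n \<le> n - 1" using form_rank_le_iff[of "n - 1"] n assms(1) by (simp add: n_def)
      thus False using n by simp
    qed
    have "\<alpha> j \<noteq> 0 \<or> \<beta> j \<noteq> 0" if "j < n" for j
      using indep[of 0 j] indep[of 0 1] that n assms(1) by (cases "j = 0") auto
    hence "n \<le> r"
      using apolar_imp_length_le[OF ap n(2) assms(2) ab indep] by blast
    thus False using n by simp
  qed
next
  assume "form_rank d q \<le> r \<or> d - r + 2 \<le> form_rank d q"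
  thus "apolar d r (dual_coeff d q)"
  proof
    assume "form_rank d q \<le> r"
    thus ?thesis using form_rank_le_iff[OF assms(1)] power_sum_imp_apolar assms(2) by blast
  next
    assume *: "d - r + 2 \<le> form_rank d q"
    show ?thesis
    proof (rule ccontr)
      assume "\<not> ?thesis"
      from not_apolar_imp_power_sum[OF this assms] have "form_rank d q \<le> Suc d - r"
        using form_rank_le_iff[of "Suc d - r"] assms by simp
      thus False using * assms by simp
    qed
  qed
qed

end

section \<open>Zariski closure\<close>

lemma zariski_closure_iff:
  assumes "A \<subseteq> binary_forms d"
  shows "q \<in> zariski_closure d A \<longleftrightarrow> q \<in> binary_forms d \<and>
    (\<forall>f. polynomial_on_forms d f \<longrightarrow> (\<forall>p\<in>A. f p = 0) \<longrightarrow> f q = 0)"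
proof
  assume q: "q \<in> zariski_closure d A"
  let ?F = "{f. polynomial_on_forms d f \<and> (\<forall>p\<in>A. f p = 0)}"
  let ?Z = "{q \<in> binary_forms d. \<forall>f\<in>?F. f q = 0}"
  have "zariski_closed d ?Z"
    unfolding zariski_closed_def by (intro exI[of _ ?F]) simp
  moreover have "A \<subseteq> ?Z" using assms by auto
  ultimately have "zariski_closure d A \<subseteq> ?Z"
    unfolding zariski_closure_def by (intro hull_minimal)
  with q show "q \<in> binary_forms d \<and>
    (\<forall>f. polynomial_on_forms d f \<longrightarrow> (\<forall>p\<in>A. f p = 0) \<longrightarrow> f q = 0)" by blast
next
  assume *: "q \<in> binary_forms d \<and>
    (\<forall>f. polynomial_on_forms d f \<longrightarrow> (\<forall>p\<in>A. f p = 0) \<longrightarrow> f q = 0)"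
  show "q \<in> zariski_closure d A"
    unfolding zariski_closure_def hull_def
  proof clarify
    fix Z assume Z: "zariski_closed d Z" "A \<subseteq> Z"
    then obtain F where F: "\<forall>f\<in>F. polynomial_on_forms d f"
      "Z = {q \<in> binary_forms d. \<forall>f\<in>F. f q = 0}"
      unfolding zariski_closed_def by blast
    with Z * show "q \<in> Z" by blast
  qed
qed

lemma polynomial_along_curve:
  fixes P :: "nat \<Rightarrow> 'a::field_char_0 poly"
  assumes "polynomial_on_forms d f"
  shows "\<exists>p. \<forall>t. f (form_of_seq d (\<lambda>m. poly (P m) t)) = poly p t"
  using assms
proof induction
  case (const c)
  show ?case by (intro exI[of _ "[:c:]"]) simp
next
  case (coord i j)
  thus ?case
    by (intro exI[of _ "Polynomial.smult (of_nat (d choose j)) (P j)"])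
       (simp add: coeff_form_of_seq)
next
  case (add f g)
  then obtain p q where "\<forall>t. f (form_of_seq d (\<lambda>m. poly (P m) t)) = poly p t"
    "\<forall>t. g (form_of_seq d (\<lambda>m. poly (P m) t)) = poly q t" by blast
  thus ?case by (intro exI[of _ "p + q"]) simp
next
  case (mult f g)
  then obtain p q where "\<forall>t. f (form_of_seq d (\<lambda>m. poly (P m) t)) = poly p t"
    "\<forall>t. g (form_of_seq d (\<lambda>m. poly (P m) t)) = poly q t" by blast
  thus ?case by (intro exI[of _ "p * q"]) simp
qed

text \<open>
  A polynomial function restricted to the curve is a polynomial in \<open>t\<close>, which is zero once it
  has infinitely many roots. This replaces all arguments with limits.
\<close>

lemma curve_limit_in_closure:
  fixes P :: "nat \<Rightarrow> 'a::field_char_0 poly"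
  assumes A: "A \<subseteq> binary_forms d"
    and fin: "finite {t. form_of_seq d (\<lambda>m. poly (P m) t) \<notin> A}"
  shows "form_of_seq d (\<lambda>m. poly (P m) 0) \<in> zariski_closure d A"
  unfolding zariski_closure_iff[OF A]
proof (intro conjI allI impI form_of_seq_in)
  fix f assume f: "polynomial_on_forms d f" "\<forall>p\<in>A. f p = 0"
  obtain p where p: "\<And>t. f (form_of_seq d (\<lambda>m. poly (P m) t)) = poly p t"
    using polynomial_along_curve[OF f(1)] by blast
  have "UNIV \<subseteq> {t. form_of_seq d (\<lambda>m. poly (P m) t) \<notin> A} \<union> {t. poly p t = 0}"
    using f(2) p by auto
  hence "p = 0"
    using fin poly_roots_finite[of p] infinite_UNIV_char_0 by (meson finite_UnI finite_subset)
  thus "f (form_of_seq d (\<lambda>m. poly (P m) 0)) = 0" by (simp add: p)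
qed

lemma polynomial_on_forms_sum:
  assumes "\<And>i. i \<in> I \<Longrightarrow> polynomial_on_forms d (f i)"
  shows "polynomial_on_forms d (\<lambda>q. \<Sum>i\<in>I. f i q)"
  using assms
  by (induction I rule: infinite_finite_induct)
     (auto intro: polynomial_on_forms.intros)

lemma polynomial_on_forms_prod:
  assumes "\<And>i. i \<in> I \<Longrightarrow> polynomial_on_forms d (f i)"
  shows "polynomial_on_forms d (\<lambda>q. \<Prod>i\<in>I. f i q)"
  using assms
  by (induction I rule: infinite_finite_induct)
     (auto intro: polynomial_on_forms.intros)

lemma polynomial_on_forms_dual_coeff:
  assumes "m \<le> d"
  shows "polynomial_on_forms d (\<lambda>q. dual_coeff d q m)"
proof -
  have "polynomial_on_forms d (\<lambda>q. coeff (coeff q m) (d - m) * inverse (of_nat (d choose m)))"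
    using assms by (intro polynomial_on_forms.intros) auto
  thus ?thesis by (simp add: dual_coeff_def divide_inverse)
qed

definition apolar_forms :: "nat \<Rightarrow> nat \<Rightarrow> 'a::field_char_0 poly poly set" where
  "apolar_forms d r = {q \<in> binary_forms d. apolar d r (dual_coeff d q)}"

definition power_sum_forms :: "nat \<Rightarrow> nat \<Rightarrow> 'a::field_char_0 poly poly set" where
  "power_sum_forms d r = {q \<in> binary_forms d. power_sum d r (dual_coeff d q)}"

lemma form_of_seq_in_power_sum_forms:
  "form_of_seq d a \<in> power_sum_forms d r \<longleftrightarrow> power_sum d r a"
  by (simp add: power_sum_forms_def form_of_seq_in power_sum_cong[OF dual_coeff_form_of_seq])

text \<open>
  The matrix is a product of a constant matrix \<open>B\<close> with the Hankel matrix of \<open>a\<close>, and the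
  coefficient vector of the annihilating polynomial lies in the kernel of the latter.
\<close>

lemma det_contraction_zero:
  fixes a :: "nat \<Rightarrow> 'a::field_char_0"
  assumes "apolar d r a" "r \<le> d"
  shows "det (mat (Suc r) (Suc r) (\<lambda>(k, l). \<Sum>m\<le>d - r. B k m * a (l + m))) = 0"
    (is "det ?M = 0")
proof -
  obtain g where g: "g \<noteq> 0" "degree g \<le> r" "\<And>m. m + r \<le> d \<Longrightarrow> contract g a m = 0"
    using assms(1) unfolding apolar_def by blast
  define v where "v = vec (Suc r) (coeff g)"
  have "v \<noteq> 0\<^sub>v (Suc r)"
  proof
    assume "v = 0\<^sub>v (Suc r)"
    hence "v $ degree g = 0" using g(2) by simp
    thus False using g(1,2) by (simp add: v_def)
  qed
  moreover have "?M *\<^sub>v v = 0\<^sub>v (Suc r)"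
  proof (rule eq_vecI)
    fix k assume k: "k < dim_vec (0\<^sub>v (Suc r) :: 'a vec)"
    have "(?M *\<^sub>v v) $ k = (\<Sum>l\<le>r. (\<Sum>m\<le>d - r. B k m * a (l + m)) * coeff g l)"
      using k by (simp add: v_def scalar_prod_def atLeast0LessThan lessThan_Suc_atMost)
    also have "\<dots> = (\<Sum>m\<le>d - r. B k m * (\<Sum>l\<le>r. coeff g l * a (l + m)))"
      unfolding sum_distrib_left sum_distrib_right
      by (subst sum.swap) (simp add: mult_ac)
    also have "\<dots> = (\<Sum>m\<le>d - r. B k m * contract g a m)"
      by (simp add: contract_altdef[OF g(2)])
    also have "\<dots> = 0" using g(3) assms(2) by (intro sum.neutral) auto
    finally show "(?M *\<^sub>v v) $ k = 0\<^sub>v (Suc r) $ k" using k by simp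
  qed simp
  moreover have "v \<in> carrier_vec (Suc r)" by (simp add: v_def)
  ultimately show ?thesis
    using det_0_iff_vec_prod_zero_field[of ?M "Suc r"] by auto
qed

lemma contraction_left_inverse:
  fixes a :: "nat \<Rightarrow> 'a::field_char_0"
  assumes "\<not> apolar d r a" "r \<le> d"
  shows "\<exists>B. \<forall>k l. l \<le> r \<longrightarrow> (\<Sum>m\<le>d - r. B k m * a (l + m)) = (if k = l then 1 else 0)"
proof -
  have "\<exists>c. \<forall>p\<in>{p. degree p \<le> r}. coeff p k = (\<Sum>m<Suc (d - r). c m * contract p a m)" for k
  proof (intro functional_in_span poly_subspace_degree_le linear_functional_contract)
    fix p assume p: "p \<in> {p. degree p \<le> r}" "\<And>m. m < Suc (d - r) \<Longrightarrow> contract p a m = 0"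
    have "contract p a m = 0" if "m + r \<le> d" for m
      using that by (intro p(2)) auto
    hence "p = 0" using assms(1) p(1) unfolding apolar_def by blast
    thus "coeff p k = 0" by simp
  qed (simp add: linear_functional_def)
  then obtain B where B: "\<And>k p. degree p \<le> r \<Longrightarrow>
      coeff p k = (\<Sum>m<Suc (d - r). B k m * contract p a m)"
    by (metis mem_Collect_eq)
  have "(\<Sum>m\<le>d - r. B k m * a (l + m)) = (if k = l then 1 else 0)" if "l \<le> r" for k l
    using B[of "monom 1 l" k] that
    by (auto simp: degree_monom_eq contract_monom coeff_monom lessThan_Suc_atMost)
  thus ?thesis by blast
qed

text \<open>
  For a form \<open>q\<close> outside the locus, the Hankel matrix of \<open>q\<close> has a left inverse \<open>B\<close>. The
  determinant of \<open>B\<close> times the Hankel matrix of a variable form is a polynomial with value $1$ at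
  \<open>q\<close> that vanishes on the locus.
\<close>

lemma zariski_closed_apolar_forms:
  assumes "r \<le> d"
  shows "zariski_closed d (apolar_forms d r :: 'a::field_char_0 poly poly set)"
proof -
  let ?X = "apolar_forms d r :: 'a poly poly set"
  let ?F = "{f. polynomial_on_forms d f \<and> (\<forall>q\<in>?X. f q = 0)}"
  have sep: "q \<in> ?X" if q: "q \<in> binary_forms d"
    and vanish: "\<And>f. polynomial_on_forms d f \<Longrightarrow> (\<And>p. p \<in> ?X \<Longrightarrow> f p = 0) \<Longrightarrow> f q = 0"
    for q :: "'a poly poly"
  proof (rule ccontr)
    assume "q \<notin> ?X"
    hence "\<not> apolar d r (dual_coeff d q)" using q by (simp add: apolar_forms_def)
    from contraction_left_inverse[OF this assms]
    obtain B where B: "\<And>k l. l \<le> r \<Longrightarrow>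
        (\<Sum>m\<le>d - r. B k m * dual_coeff d q (l + m)) = (if k = l then 1 else 0)"
      by blast
    define M where "M p = mat (Suc r) (Suc r)
      (\<lambda>(k, l). \<Sum>m\<le>d - r. B k m * dual_coeff d p (l + m))" for p :: "'a poly poly"
    have "M q = 1\<^sub>m (Suc r)"
      by (rule eq_matI) (auto simp: M_def B)
    hence "det (M q) \<noteq> 0" by simp
    have zero: "det (M p) = 0" if "p \<in> ?X" for p
      using that det_contraction_zero[OF _ assms] unfolding M_def apolar_forms_def by blast
    have "polynomial_on_forms d (\<lambda>p. det (M p))"
    proof -
      have "det (M p) = (\<Sum>\<pi> | \<pi> permutes {0..<Suc r}. signof \<pi> *
          (\<Prod>i = 0..<Suc r. \<Sum>m\<le>d - r. B i m * dual_coeff d p (\<pi> i + m)))" for p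
      proof -
        have "det (M p) = (\<Sum>\<pi> | \<pi> permutes {0..<Suc r}. signof \<pi> *
            (\<Prod>i = 0..<Suc r. M p $$ (i, \<pi> i)))"
          by (rule det_def') (simp add: M_def)
        also have "\<dots> = (\<Sum>\<pi> | \<pi> permutes {0..<Suc r}. signof \<pi> *
            (\<Prod>i = 0..<Suc r. \<Sum>m\<le>d - r. B i m * dual_coeff d p (\<pi> i + m)))"
        proof (intro sum.cong prod.cong refl arg_cong2[where f = "(*)"])
          fix \<pi> i assume "\<pi> \<in> {\<pi>. \<pi> permutes {0..<Suc r}}" "i \<in> {0..<Suc r}"
          hence "i < Suc r" "\<pi> i < Suc r" using permutes_in_image[of \<pi> "{0..<Suc r}" i] by auto
          thus "M p $$ (i, \<pi> i) = (\<Sum>m\<le>d - r. B i m * dual_coeff d p (\<pi> i + m))"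
            by (simp add: M_def)
        qed
        finally show ?thesis .
      qed
      moreover have "polynomial_on_forms d (\<lambda>p. \<Sum>\<pi> | \<pi> permutes {0..<Suc r}. signof \<pi> *
          (\<Prod>i = 0..<Suc r. \<Sum>m\<le>d - r. B i m * dual_coeff d p (\<pi> i + m)))"
      proof (intro polynomial_on_forms_sum polynomial_on_forms_prod polynomial_on_forms.mult
          polynomial_on_forms.const polynomial_on_forms_dual_coeff)
        fix \<pi> i m assume "\<pi> \<in> {\<pi>. \<pi> permutes {0..<Suc r}}" "i \<in> {0..<Suc r}" "m \<in> {..d - r}"
        hence "\<pi> i < Suc r" "m \<le> d - r" using permutes_in_image[of \<pi> "{0..<Suc r}" i] by auto
        thus "\<pi> i + m \<le> d" using assms by auto
      qed
      ultimately show ?thesis by simp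
    qed
    from vanish[OF this zero] \<open>det (M q) \<noteq> 0\<close> show False by contradiction
  qed
  show ?thesis
    unfolding zariski_closed_def
  proof (intro exI[of _ ?F] conjI)
    show "?X = {q \<in> binary_forms d. \<forall>f\<in>?F. f q = 0}"
    proof (intro equalityI subsetI)
      fix q assume "q \<in> ?X"
      moreover from this have "q \<in> binary_forms d" by (simp add: apolar_forms_def)
      ultimately show "q \<in> {q \<in> binary_forms d. \<forall>f\<in>?F. f q = 0}" by simp
    next
      fix q assume "q \<in> {q \<in> binary_forms d. \<forall>f\<in>?F. f q = 0}"
      thus "q \<in> ?X" by (intro sep) simp_all
    qed
  qed simp
qed

section \<open>The two density statements\<close>

lemma apolar_forms_subset_closure:
  assumes "1 \<le> r" "r \<le> d"
  shows "(apolar_forms d r :: 'a::{alg_closed_field, field_char_0} poly poly set)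
    \<subseteq> zariski_closure d (power_sum_forms d r)"
proof
  fix q :: "'a poly poly" assume "q \<in> apolar_forms d r"
  hence q: "q \<in> binary_forms d" "apolar d r (dual_coeff d q)"
    by (auto simp: apolar_forms_def)
  obtain P u k where P: "\<And>m. m \<le> d \<Longrightarrow> poly (P m) 0 = dual_coeff d q m" "k \<le> r"
    "\<And>t. inj_on (\<lambda>j. u j + t * of_nat j) {..<k} \<Longrightarrow> inj_on (\<lambda>j. t * of_nat j) {..<r - k} \<Longrightarrow>
      power_sum d r (\<lambda>m. poly (P m) t)"
    by (rule apolar_deformation[OF q(2) assms]) (rule that)
  have "{t. form_of_seq d (\<lambda>m. poly (P m) t) \<notin> power_sum_forms d r} \<subseteq>
      {t. \<not> inj_on (\<lambda>j. u j + t * of_nat j) {..<k}} \<union>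
      {t. \<not> inj_on (\<lambda>j. 0 + t * of_nat j) {..<r - k}}"
    using P(3) by (auto simp: form_of_seq_in_power_sum_forms)
  hence "finite {t. form_of_seq d (\<lambda>m. poly (P m) t) \<notin> power_sum_forms d r}"
    by (rule finite_subset) (intro finite_UnI finite_noninjective_parameters; simp add: inj_def)
  hence "form_of_seq d (\<lambda>m. poly (P m) 0) \<in> zariski_closure d (power_sum_forms d r)"
    by (intro curve_limit_in_closure) (auto simp: power_sum_forms_def)
  moreover have "form_of_seq d (\<lambda>m. poly (P m) 0) = q"
    using form_of_seq_dual_coeff[OF q(1)] form_of_seq_cong[OF P(1)] by simp
  ultimately show "q \<in> zariski_closure d (power_sum_forms d r)" by simp
qed

text \<open>
  A form of smaller rank \<open>n\<close> would have an apolar form of degree \<open>n\<close> with \<open>r\<close> distinct roots.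
  The independence behind this needs $n + r \le d + 1$, which holds for every $n < r$ because of
  the bound on \<open>r\<close>.
\<close>

lemma form_rank_of_independent:
  fixes \<alpha> \<beta> :: "nat \<Rightarrow> 'a::{alg_closed_field, field_char_0}"
  assumes d: "d \<ge> 1" and r: "1 \<le> r" "r \<le> d div 2 + 1"
    and indep: "\<And>i j. i < j \<Longrightarrow> j < r \<Longrightarrow> \<alpha> j * \<beta> i - \<beta> j * \<alpha> i \<noteq> 0"
  defines "a \<equiv> \<lambda>m. \<Sum>j<r. \<alpha> j ^ (d - m) * \<beta> j ^ m"
  shows "form_rank d (form_of_seq d a) = r"
proof -
  let ?q = "form_of_seq d a"
  define n where "n = form_rank d ?q"
  have "power_sum d r (dual_coeff d ?q)"
    unfolding power_sum_def by (auto simp: dual_coeff_form_of_seq a_def)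
  hence "n \<le> r"
    using form_rank_le_iff[OF d form_of_seq_in r(1), of a] by (simp only: n_def)
  have "n \<ge> 1"
    unfolding n_def by (rule form_rank_ge_1[OF d form_of_seq_in])
  have "\<not> n < r"
  proof
    assume n: "n < r"
    hence "n + r \<le> d + 1" "n \<le> d" using r by auto
    have "power_sum d n (dual_coeff d ?q)"
      using form_rank_le_iff[OF d form_of_seq_in \<open>n \<ge> 1\<close>, of a] by (simp add: n_def del: One_nat_def)
    hence ap: "apolar d n (dual_coeff d ?q)"
      using power_sum_imp_apolar \<open>n \<le> d\<close> by blast
    have nz: "\<alpha> j \<noteq> 0 \<or> \<beta> j \<noteq> 0" if "j < r" for j
      using indep[of 0 j] indep[of 0 1] that n \<open>n \<ge> 1\<close> by (cases "j = 0") auto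
    have "r \<le> n"
      by (rule apolar_imp_length_le[OF ap _ \<open>n \<le> d\<close> _ indep nz])
         (use \<open>n + r \<le> d + 1\<close> in \<open>auto simp: dual_coeff_form_of_seq a_def\<close>)
    thus False using n by simp
  qed
  thus ?thesis using \<open>n \<le> r\<close> by (simp add: n_def)
qed

text \<open>
  Adding \<open>t\<close> times the pairwise nonproportional forms $x + j y$ to the $L_j$ makes them pairwise
  nonproportional for almost all \<open>t\<close>: the determinant of two of them is a quadratic polynomial
  in \<open>t\<close> with leading coefficient $i - j$, up to sign.
\<close>

lemma power_sum_forms_subset_closure:
  assumes d: "d \<ge> 1" and r: "1 \<le> r" "r \<le> d div 2 + 1"
  shows "(power_sum_forms d r :: 'a::{alg_closed_field, field_char_0} poly poly set)
    \<subseteq> zariski_closure d (rank_stratum d r)"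
proof
  fix q :: "'a poly poly" assume "q \<in> power_sum_forms d r"
  then obtain \<alpha> \<beta> where q: "q \<in> binary_forms d"
    and ab: "\<And>m. m \<le> d \<Longrightarrow> dual_coeff d q m = (\<Sum>j<r. \<alpha> j ^ (d - m) * \<beta> j ^ m)"
    by (auto simp: power_sum_forms_def power_sum_def)
  define A where "A j = [:\<alpha> j, 1:]" for j
  define B where "B j = [:\<beta> j, of_nat j:]" for j
  define P where "P m = (\<Sum>j<r. A j ^ (d - m) * B j ^ m)" for m
  have "A j * B i - B j * A i \<noteq> 0" if "i < j" for i j
  proof
    assume "A j * B i - B j * A i = 0"
    hence "coeff (A j * B i - B j * A i) 2 = 0" by simp
    moreover have "coeff (A j * B i - B j * A i) 2 = of_nat i - of_nat j"
      by (simp add: A_def B_def numeral_2_eq_2)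
    ultimately show False using that by simp
  qed
  hence "finite (\<Union>j<r. \<Union>i<j. {t. poly (A j * B i - B j * A i) t = 0})"
    by (intro finite_UN_I poly_roots_finite) auto
  moreover have "{t. form_of_seq d (\<lambda>m. poly (P m) t) \<notin> rank_stratum d r} \<subseteq>
      (\<Union>j<r. \<Union>i<j. {t. poly (A j * B i - B j * A i) t = 0})"
  proof (rule subsetI, rule ccontr)
    fix t assume t: "t \<in> {t. form_of_seq d (\<lambda>m. poly (P m) t) \<notin> rank_stratum d r}"
      "t \<notin> (\<Union>j<r. \<Union>i<j. {t. poly (A j * B i - B j * A i) t = 0})"
    have "form_rank d (form_of_seq d (\<lambda>m. \<Sum>j<r. poly (A j) t ^ (d - m) * poly (B j) t ^ m)) = r"
      using t(2) by (intro form_rank_of_independent d r) auto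
    hence "form_of_seq d (\<lambda>m. poly (P m) t) \<in> rank_stratum d r"
      by (simp add: rank_stratum_def form_of_seq_in P_def poly_sum)
    with t(1) show False by simp
  qed
  ultimately have "finite {t. form_of_seq d (\<lambda>m. poly (P m) t) \<notin> rank_stratum d r}"
    using finite_subset by blast
  hence "form_of_seq d (\<lambda>m. poly (P m) 0) \<in> zariski_closure d (rank_stratum d r)"
    by (intro curve_limit_in_closure) (auto simp: rank_stratum_def)
  moreover have "form_of_seq d (\<lambda>m. poly (P m) 0) = form_of_seq d (dual_coeff d q)"
    by (intro form_of_seq_cong) (simp add: ab P_def A_def B_def poly_sum)
  ultimately show "q \<in> zariski_closure d (rank_stratum d r)"
    using form_of_seq_dual_coeff[OF q] by simp
qed

theorem mainTheorem2:
  fixes d r :: nat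
  assumes "d \<ge> 1" and "1 \<le> r" and "r \<le> d div 2 + 1"
  shows "zariski_closure d (rank_stratum d r :: 'a::{alg_closed_field, field_char_0} poly poly set) =
    (\<Union>i\<in>{1..r}. rank_stratum d i) \<union> (\<Union>i\<in>{d - r + 2..d}. rank_stratum d i)"
proof -
  have "r \<le> d" using assms by linarith
  have X: "apolar_forms d r = {q \<in> binary_forms d :: 'a poly poly set.
      form_rank d q \<le> r \<or> d - r + 2 \<le> form_rank d q}"
    unfolding apolar_forms_def using apolar_iff_form_rank[OF assms(1) _ assms(2) \<open>r \<le> d\<close>] by blast
  have "zariski_closure d (rank_stratum d r) \<subseteq> (apolar_forms d r :: 'a poly poly set)"
    unfolding zariski_closure_def
    by (intro hull_minimal zariski_closed_apolar_forms \<open>r \<le> d\<close>) (auto simp: X rank_stratum_def)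
  moreover have "(apolar_forms d r :: 'a poly poly set) \<subseteq> zariski_closure d (rank_stratum d r)"
  proof -
    have "(apolar_forms d r :: 'a poly poly set) \<subseteq> zariski_closure d (power_sum_forms d r)"
      using assms(2) \<open>r \<le> d\<close> by (rule apolar_forms_subset_closure)
    also have "\<dots> \<subseteq> zariski_closure d (zariski_closure d (rank_stratum d r))"
      unfolding zariski_closure_def
      using power_sum_forms_subset_closure[OF assms]
      by (intro hull_mono) (simp add: zariski_closure_def)
    also have "\<dots> = zariski_closure d (rank_stratum d r)"
      unfolding zariski_closure_def by simp
    finally show ?thesis .
  qed
  moreover have "apolar_forms d r =
      ((\<Union>i\<in>{1..r}. rank_stratum d i) \<union> (\<Union>i\<in>{d - r + 2..d}. rank_stratum d i)
        :: 'a poly poly set)"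
  proof -
    have "1 \<le> form_rank d q" "form_rank d q \<le> d"
      if "q \<in> binary_forms d" for q :: "'a poly poly"
      using form_rank_ge_1[OF assms(1) that] form_rank_le[OF assms(1) that] .
    thus ?thesis unfolding X rank_stratum_def by auto
  qed
  ultimately show ?thesis by blast
qed

end
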